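(* For all $m\ge 2$ there is a properly $m$-tardy c.e. set $A$ satisfying $Q_m(A)$.
   Context: Sets are subsets of $\omega$; $\{W_{e}\}_{e\in\omega}$ is the standard listing of the c.e. sets with standard stagewise enumeration $\{W_{e,s}\}_{s\in\omega}$ (only numbers less than $s$ belong to $W_{e,s}$). $\overline{A}=\omega\setminus A$; $X\subseteq^* Y$ means $X\setminus Y$ is finite. $n$-c.e. sets: for $n\ge 1$, a set $X$ is $n$-c.e. iff there are c.e. sets $X_1,\dots,X_n$ such that $X=(X_1-X_2)\cup\dots\cup(X_{n-2}-X_{n-1})\cup X_n$ if $n$ is odd, and $X=(X_1-X_2)\cup\dots\cup(X_{n-1}-X_n)$ if $n$ is even. Fix an effective listing of all such presentations (sequences $W_{e_1},\dots,W_{e_n}$ of c.e. sets given by indices); $X^n_e$ denotes the $e$-th $n$-c.e. set in this listing, and $X^n_{e,s}$ its stage-$s$ approximation, obtained by replacing each $W_{e_i}$ by $W_{e_i,s}$. $n$-tardy: let $A$ be c.e. with a computable enumeration $\{A_s\}_{s\in\omega}$. $A$ is $n$-tardy iff for every nondecreasing total computable function $p$ there is an $e$ such that $X^n_e=\overline{A}$ and, for all $x$ and all $s$, $x\in X^n_{e,s}$ implies $x\notin A_{p(s)}$. (This does not depend on the choice of enumeration of $A$.) $A$ is properly $n$-tardy if $A$ is $n$-tardy but not $(n-1)$-tardy. $A\subset_m C$ (equivalently $C\supset_m A$; $A$ is a major subset of $C$): $A\subseteq C$, $C-A$ is infinite, and for all $e$, $\overline{C}\subseteq W_e$ implies $\overline{A}\subseteq^*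 W_e$. $S\sqsubset C$: there is a c.e. set $B$ with $S\cup B=C$ and $S\cap B=\emptyset$. The properties $Q_m$, $m\ge 2$ (all set quantifiers range over c.e. sets). For $k\ge 1$, $Q_{2k}(A)$ is the statement $$(\exists C\supset_m A)(\forall B_1\subseteq C)(\forall B_2\subseteq B_1)\cdots(\forall B_k\subseteq B_{k-1})(\exists D_1\subseteq C)(\exists D_2\subseteq D_1)\cdots(\exists D_k\subseteq D_{k-1})$$ $$(\forall S\sqsubset C)(\exists T_1\supseteq\overline{C})(\exists T_2\subseteq T_1)\cdots(\exists T_k\subseteq T_{k-1})\,[\Phi\implies\Psi],$$ where $\Phi$ is: $B_i\cap(S-A)=D_i\cap(S-A)$ for all $1\le i\le k$; and $\Psi$ is: $(A\cup T_{i+1})\cap(S\cap T_i)=B_i\cap(S\cap T_i)$ for all $1\le i<k$, and $A\cap(S\cap T_k)=B_k\cap(S\cap T_k)$. For $k\ge 1$, $Q_{2k+1}(A)$ is the statement $(\exists Y\subseteq\overline{A})\,Q_{2k}(A\cup Y)$. *)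

theory Defs
  imports Main "HOL-Library.Nat_Bijection"
begin

section \<open>Partial computable functions\<close>

text \<open>
  Programs for the partial recursive functions, all taken to be unary: several arguments are
  passed as one by means of the Cantor pairing function \<^const>\<open>prod_encode\<close>.
  \<open>Prec\<close> is primitive recursion and \<open>Mu\<close> is unbounded minimisation.
\<close>

datatype prog =
    Zero
  | Succ
  | Fst
  | Snd
  | Pair prog prog
  | Comp prog prog
  | Prec prog prog
  | Mu prog

text \<open>\<open>runs p x y t\<close>: on input \<open>x\<close> the program \<open>p\<close> halts with output \<open>y\<close> after exactly
  \<open>t\<close> steps. In the rule for \<open>Mu\<close>, all values below the least zero have to be defined.\<close>

inductive runs :: "prog \<Rightarrow> nat \<Rightarrow> nat \<Rightarrow> nat \<Rightarrow> bool" where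
  runs_Zero: "runs Zero x 0 1"
| runs_Succ: "runs Succ x (Suc x) 1"
| runs_Fst: "runs Fst (prod_encode (a, b)) a 1"
| runs_Snd: "runs Snd (prod_encode (a, b)) b 1"
| runs_Pair: "runs p x y t \<Longrightarrow> runs q x z u \<Longrightarrow>
    runs (Pair p q) x (prod_encode (y, z)) (Suc (t + u))"
| runs_Comp: "runs q x y t \<Longrightarrow> runs p y z u \<Longrightarrow> runs (Comp p q) x z (Suc (t + u))"
| runs_Prec_0: "runs p a y t \<Longrightarrow> runs (Prec p q) (prod_encode (a, 0)) y (Suc t)"
| runs_Prec_Suc: "runs (Prec p q) (prod_encode (a, n)) r t \<Longrightarrow>
    runs q (prod_encode (a, prod_encode (n, r))) y u \<Longrightarrow>
    runs (Prec p q) (prod_encode (a, Suc n)) y (Suc (t + u))"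
| runs_Mu: "\<forall>j<m. runs p (prod_encode (a, j)) (Suc (v j)) (t j) \<Longrightarrow>
    runs p (prod_encode (a, m)) 0 (t m) \<Longrightarrow>
    runs (Mu p) a m (Suc (\<Sum>j\<le>m. t j))"

definition computable :: "(nat \<Rightarrow> nat) \<Rightarrow> bool" where
  "computable f \<longleftrightarrow> (\<exists>p. \<forall>x. \<exists>t. runs p x (f x) t)"


section \<open>The standard listing of the c.e. sets\<close>

text \<open>Goedel numbering of programs; it is a bijection onto the natural numbers.\<close>

primrec code :: "prog \<Rightarrow> nat" where
  "code Zero = 0"
| "code Succ = 1"
| "code Fst = 2"
| "code Snd = 3"
| "code (Pair p q) = 4 * prod_encode (code p, code q) + 4"
| "code (Comp p q) = 4 * prod_encode (code p, code q) + 5"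
| "code (Prec p q) = 4 * prod_encode (code p, code q) + 6"
| "code (Mu p) = 4 * code p + 7"

lemma inj_code: "inj code"
proof (rule injI)
  fix p q assume "code p = code q"
  then show "p = q"
  proof (induction p arbitrary: q)
    case Zero then show ?case by (cases q) auto
  next
    case Succ then show ?case by (cases q) auto
  next
    case Fst then show ?case by (cases q) auto
  next
    case Snd then show ?case by (cases q) auto
  next
    case (Pair p1 p2) from Pair.prems show ?case by (cases q) (auto intro: Pair.IH; presburger)+
  next
    case (Comp p1 p2) from Comp.prems show ?case by (cases q) (auto intro: Comp.IH; presburger)+
  next
    case (Prec p1 p2) from Prec.prems show ?case by (cases q) (auto intro: Prec.IH; presburger)+
  next
    case (Mu p) from Mu.prems show ?case by (cases q) (auto intro: Mu.IH; presburger)+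
  qed
qed

lemma surj_code: "\<exists>p. code p = e"
proof (induction e rule: less_induct)
  case (less e)
  show ?case
  proof (cases "e < 4")
    case True
    then have "e = 0 \<or> e = 1 \<or> e = 2 \<or> e = 3" by linarith
    then show ?thesis by (metis code.simps(1-4))
  next
    case False
    define m where "m = (e - 4) div 4"
    obtain a b where ab: "m = prod_encode (a, b)"
      by (metis prod_decode_inverse surj_pair)
    have "m < e" using False unfolding m_def by linarith
    moreover have "a \<le> m" "b \<le> m" by (simp_all add: ab le_prod_encode_1 le_prod_encode_2)
    ultimately obtain p q r where pqr: "code p = a" "code q = b" "code r = m"
      by (meson less le_less_trans)
    have "e = 4 * m + 4 \<or> e = 4 * m + 5 \<or> e = 4 * m + 6 \<or> e = 4 * m + 7"
      using False unfolding m_def by presburger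
    then show ?thesis using pqr ab by (metis code.simps(5-8))
  qed
qed

definition W :: "nat \<Rightarrow> nat set" where
  "W e = {x. \<exists>p y t. code p = e \<and> runs p x y t}"

definition W_at :: "nat \<Rightarrow> nat \<Rightarrow> nat set" where
  "W_at e s = {x. x < s \<and> (\<exists>p y t. code p = e \<and> runs p x y t \<and> t < s)}"

lemma W_at_mono: "s \<le> s' \<Longrightarrow> W_at e s \<subseteq> W_at e s'"
  unfolding W_at_def by fastforce

lemma W_eq_UN_W_at: "W e = (\<Union>s. W_at e s)"
proof (intro equalityI subsetI)
  fix x assume "x \<in> W e"
  then obtain p y t where "code p = e" "runs p x y t" unfolding W_def by blast
  then have "x \<in> W_at e (Suc (x + t))" unfolding W_at_def by fastforce
  then show "x \<in> (\<Union>s. W_at e s)" by blast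
qed (auto simp: W_def W_at_def)

definition ce :: "nat set \<Rightarrow> bool" where
  "ce A \<longleftrightarrow> (\<exists>e. A = W e)"

text \<open>An increasing enumeration by finite sets, given uniformly by canonical indices:
  \<^const>\<open>set_decode\<close> \<open>n\<close> is the finite set with canonical index \<open>n\<close>.\<close>

definition computable_enumeration :: "(nat \<Rightarrow> nat set) \<Rightarrow> nat set \<Rightarrow> bool" where
  "computable_enumeration As A \<longleftrightarrow>
     (\<exists>f. computable f \<and> (\<forall>s. As s = set_decode (f s))) \<and>
     (\<forall>s. As s \<subseteq> As (Suc s)) \<and> (\<Union>s. As s) = A"


section \<open>The \<open>n\<close>-c.e. sets and tardiness\<close>

text \<open>\<open>alt_union [X\<^sub>1, \<dots>, X\<^sub>n]\<close> is \<open>(X\<^sub>1 - X\<^sub>2) \<union> (X\<^sub>3 - X\<^sub>4) \<union> \<dots>\<close>, the last member of the union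
  being \<open>X\<^sub>n\<close> if \<open>n\<close> is odd and \<open>X\<^bsub>n-1\<^esub> - X\<^sub>n\<close> if \<open>n\<close> is even.\<close>

fun alt_union :: "nat set list \<Rightarrow> nat set" where
  "alt_union [] = {}"
| "alt_union [X] = X"
| "alt_union (X # Y # Zs) = (X - Y) \<union> alt_union Zs"

text \<open>For \<open>n \<ge> 1\<close>, \<open>tuple_decode n\<close> is an effective bijection of the natural numbers with the
  lists of length \<open>n\<close>.\<close>

fun tuple_decode :: "nat \<Rightarrow> nat \<Rightarrow> nat list" where
  "tuple_decode 0 e = []"
| "tuple_decode (Suc 0) e = [e]"
| "tuple_decode (Suc (Suc n)) e =
     fst (prod_decode e) # tuple_decode (Suc n) (snd (prod_decode e))"

lemma length_tuple_decode: "length (tuple_decode n e) = n"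
  by (induction n e rule: tuple_decode.induct) auto

lemma tuple_decode_surj: "length es = Suc n \<Longrightarrow> \<exists>e. tuple_decode (Suc n) e = es"
proof (induction n arbitrary: es)
  case 0
  then show ?case by (cases es) auto
next
  case (Suc n)
  then obtain a es' where es: "es = a # es'" "length es' = Suc n" by (cases es) auto
  with Suc.IH obtain e where "tuple_decode (Suc n) e = es'" by blast
  then have "tuple_decode (Suc (Suc n)) (prod_encode (a, e)) = es" by (simp add: es)
  then show ?case by blast
qed

definition X_nce :: "nat \<Rightarrow> nat \<Rightarrow> nat set" where
  "X_nce n e = alt_union (map W (tuple_decode n e))"

definition X_nce_at :: "nat \<Rightarrow> nat \<Rightarrow> nat \<Rightarrow> nat set" where
  "X_nce_at n e s = alt_union (map (\<lambda>i. W_at i s) (tuple_decode n e))"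

text \<open>The condition is independent of the choice of the computable enumeration \<open>As\<close> of \<open>A\<close>;
  only \<open>n \<ge> 1\<close> (resp. \<open>n \<ge> 2\<close> for proper tardiness) is meaningful.\<close>

definition tardy :: "nat \<Rightarrow> nat set \<Rightarrow> bool" where
  "tardy n A \<longleftrightarrow>
     (\<exists>As. computable_enumeration As A \<and>
       (\<forall>p. computable p \<and> mono p \<longrightarrow>
         (\<exists>e. X_nce n e = - A \<and> (\<forall>x s. x \<in> X_nce_at n e s \<longrightarrow> x \<notin> As (p s)))))"

definition properly_tardy :: "nat \<Rightarrow> nat set \<Rightarrow> bool" where
  "properly_tardy n A \<longleftrightarrow> tardy n A \<and> \<not> tardy (n - 1) A"


section \<open>The properties \<open>Q\<^sub>m\<close>\<close>

definition major_subset :: "nat set \<Rightarrow> nat set \<Rightarrow> bool" where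
  "major_subset A C \<longleftrightarrow>
     A \<subseteq> C \<and> infinite (C - A) \<and> (\<forall>e. - C \<subseteq> W e \<longrightarrow> finite (- A - W e))"

definition splits :: "nat set \<Rightarrow> nat set \<Rightarrow> bool" where
  "splits S C \<longleftrightarrow> (\<exists>B. ce B \<and> S \<union> B = C \<and> S \<inter> B = {})"

text \<open>\<open>ce_chain k B\<close>: the sets \<open>B 1 \<supseteq> \<dots> \<supseteq> B k\<close> are c.e.; other values of \<open>B\<close> are irrelevant. A block
  of \<open>k\<close> like set quantifiers is expressed by one quantifier over such a sequence.\<close>

definition ce_chain :: "nat \<Rightarrow> (nat \<Rightarrow> nat set) \<Rightarrow> bool" where
  "ce_chain k B \<longleftrightarrow> (\<forall>i. 1 \<le> i \<and> i \<le> k \<longrightarrow> ce (B i)) \<and> (\<forall>i. 1 \<le> i \<and> i < k \<longrightarrow> B (i + 1) \<subseteq> B i)"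

definition Phi :: "nat \<Rightarrow> nat set \<Rightarrow> (nat \<Rightarrow> nat set) \<Rightarrow> (nat \<Rightarrow> nat set) \<Rightarrow> nat set \<Rightarrow> bool" where
  "Phi k A B D S \<longleftrightarrow> (\<forall>i. 1 \<le> i \<and> i \<le> k \<longrightarrow> B i \<inter> (S - A) = D i \<inter> (S - A))"

definition Psi :: "nat \<Rightarrow> nat set \<Rightarrow> (nat \<Rightarrow> nat set) \<Rightarrow> nat set \<Rightarrow> (nat \<Rightarrow> nat set) \<Rightarrow> bool" where
  "Psi k A B S T \<longleftrightarrow>
     (\<forall>i. 1 \<le> i \<and> i < k \<longrightarrow> (A \<union> T (i + 1)) \<inter> (S \<inter> T i) = B i \<inter> (S \<inter> T i)) \<and>
     A \<inter> (S \<inter> T k) = B k \<inter> (S \<inter> T k)"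

definition Q_even :: "nat \<Rightarrow> nat set \<Rightarrow> bool" where
  "Q_even k A \<longleftrightarrow>
     (\<exists>C. ce C \<and> major_subset A C \<and>
       (\<forall>B. ce_chain k B \<and> B 1 \<subseteq> C \<longrightarrow>
         (\<exists>D. ce_chain k D \<and> D 1 \<subseteq> C \<and>
           (\<forall>S. ce S \<and> splits S C \<longrightarrow>
             (\<exists>T. ce_chain k T \<and> - C \<subseteq> T 1 \<and> (Phi k A B D S \<longrightarrow> Psi k A B S T))))))"

text \<open>\<open>Q_even k\<close> is \<open>Q\<^bsub>2k\<^esub>\<close>; the definition of \<open>Q m\<close> is meant for \<open>m \<ge> 2\<close>.\<close>

definition Q :: "nat \<Rightarrow> nat set \<Rightarrow> bool" where
  "Q m A \<longleftrightarrow>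
     (if even m then Q_even (m div 2) A
      else \<exists>Y. ce Y \<and> Y \<subseteq> - A \<and> Q_even (m div 2) (A \<union> Y))"

end

theory Submission
  imports Defs
begin

text \<open>
  Put \<open>k = m div 2\<close>. An element \<open>x\<close> of \<open>C\<close> may enter \<open>H = A \<union> Y\<close> only after up to \<open>k\<close> rounds of
  questions: in round \<open>l\<close> it is put into \<open>D l\<close> for one chain \<open>B\<close> after the other and has to wait
  until it shows up in \<open>B l\<close>. If an answer never comes, then \<open>Phi\<close> fails at \<open>x\<close>; if all of them
  come, then \<open>x\<close> either moves to the next round, and thereby into \<open>T (l + 1)\<close>, or into \<open>H\<close>, so
  that \<open>Psi\<close> is true of \<open>x\<close>. The requirements with the highest priority are asked last, because
  a question that has been answered binds \<open>x\<close> only from then on.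

  Whether the hypotheses of a requirement are true is a \<open>\<Pi>\<^sub>2\<close> question. Instead of a tree of
  strategies there is a guess attached in advance to every number \<open>x\<close>: \<open>x\<close> enters \<open>C\<close> when the set
  of requirements below its level that have come true on \<open>x\<close> coincides with the guess, and once
  a further requirement comes true the guess is refuted and \<open>x\<close> is sent to \<open>A\<close>, asking only the
  requirements of higher priority. This makes \<open>H\<close> a major subset of \<open>C\<close>. Each level \<open>n\<close> keeps an
  element of \<open>C\<close> whose guess is correct. For \<open>n = 2 * e\<close> it diagonalises against the \<open>e\<close>-th
  \<open>(m - 1)\<close>-c.e. set \<open>X\<close>: a round begins when \<open>x\<close> is in \<open>X\<close>, and at its end \<open>x\<close> goes into \<open>A\<close> at
  once if it is still in \<open>X\<close>. Otherwise \<open>X\<close> has used up two of its alternations, and after \<open>k\<close>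
  rounds none is left.

  That \<open>A\<close> is \<open>m\<close>-tardy follows from the \<open>Q\<close> property for the trivial splitting and a chain \<open>B\<close>
  that delays its answers as long as the given function demands.
\<close>

section \<open>Computable functions and decidable predicates\<close>

lemma runs_fun: "runs p x y t \<Longrightarrow> runs p x y' t' \<Longrightarrow> y = y' \<and> t = t'"
proof (induction arbitrary: y' t' rule: runs.induct)
  case (runs_Zero x) then show ?case by cases auto
next
  case (runs_Succ x) then show ?case by cases auto
next
  case (runs_Fst a b) then show ?case by cases auto
next
  case (runs_Snd a b) then show ?case by cases auto
next
  case (runs_Pair p x y t q z u)
  from runs_Pair.prems show ?case by cases (auto dest: runs_Pair.IH)
next
  case (runs_Comp q x y t p z u)
  from runs_Comp.prems show ?case by cases (auto dest!: runs_Comp.IH)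
next
  case (runs_Prec_0 p a y t q)
  from runs_Prec_0.prems show ?case by cases (auto dest: runs_Prec_0.IH)
next
  case (runs_Prec_Suc p q a n r t y u)
  from runs_Prec_Suc.prems show ?case
    by cases (auto dest!: runs_Prec_Suc.IH)
next
  case (runs_Mu m p a v t)
  from runs_Mu.prems show ?case
  proof cases
    case mu: (runs_Mu v' t')
    have "\<not> y' < m" using mu(3) runs_Mu.IH(1) by blast
    moreover have "\<not> m < y'" using mu(2) runs_Mu.IH(2) by force
    ultimately have m: "y' = m" by simp
    have "t j = t' j" if "j \<le> m" for j
    proof (cases "j = m")
      case True then show ?thesis using runs_Mu.IH(2) mu(3) m by blast
    next
      case False
      then have "j < m" using that by simp
      then show ?thesis using runs_Mu.IH(1) mu(2) m by blast
    qed
    then show ?thesis using mu(1) m by auto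
  qed
qed

definition decidable :: "(nat \<Rightarrow> bool) \<Rightarrow> bool" where
  "decidable P \<longleftrightarrow> computable (\<lambda>z. of_bool (P z))"

abbreviation p1 :: "nat \<Rightarrow> nat" where "p1 z \<equiv> fst (prod_decode z)"
abbreviation p2 :: "nat \<Rightarrow> nat" where "p2 z \<equiv> snd (prod_decode z)"

text \<open>The rules speak of composed arguments such as \<open>f z\<close>, so that
  \<open>intro comp\<close> settles computability along the syntax of a term. Under a binder,
  \<open>p1 w\<close> stands for the outer argument and \<open>p2 w\<close> for what is
  bound.\<close>

named_theorems comp

lemma computableI: "(\<And>x. \<exists>t. runs p x (f x) t) \<Longrightarrow> computable f"
  unfolding computable_def by blast

lemma runs_pair_id: "runs (Pair Fst Snd) x x 3"
proof -
  obtain a b where x: "x = prod_encode (a, b)" by (metis prod_decode_inverse surj_pair)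
  show ?thesis using runs_Pair[OF runs_Fst[of a b] runs_Snd[of a b]] by (simp add: x numeral_3_eq_3)
qed

lemma comp_id [comp]: "computable (\<lambda>z. z)"
  using runs_pair_id by (blast intro: computableI)

lemma runs_p1: "runs Fst x (p1 x) 1"
  by (metis runs_Fst prod.collapse prod_decode_inverse)

lemma runs_p2: "runs Snd x (p2 x) 1"
  by (metis runs_Snd prod.collapse prod_decode_inverse)

lemma comp_comp: "computable f \<Longrightarrow> computable g \<Longrightarrow> computable (\<lambda>z. f (g z))"
  unfolding computable_def by (meson runs_Comp)

lemma comp_pair [comp]: "computable f \<Longrightarrow> computable g \<Longrightarrow> computable (\<lambda>z. prod_encode (f z, g z))"
  unfolding computable_def by (meson runs_Pair)

lemma comp_p1 [comp]: "computable f \<Longrightarrow> computable (\<lambda>z. p1 (f z))"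
  by (rule comp_comp[of p1]) (blast intro: computableI runs_p1)

lemma comp_p2 [comp]: "computable f \<Longrightarrow> computable (\<lambda>z. p2 (f z))"
  by (rule comp_comp[of p2]) (blast intro: computableI runs_p2)

lemma comp_Suc [comp]: "computable f \<Longrightarrow> computable (\<lambda>z. Suc (f z))"
  by (rule comp_comp[of Suc]) (blast intro: computableI runs_Succ)

lemma comp_const [comp]: "computable (\<lambda>z. c)"
proof (induction c)
  case 0 show ?case by (blast intro: computableI runs_Zero)
next
  case (Suc c) then show ?case by (rule comp_Suc)
qed

lemma comp_rec [comp]:
  assumes b: "computable b" and g: "computable g"
    and h: "computable (\<lambda>w. h (p1 w) (p1 (p2 w)) (p2 (p2 w)))"
  shows "computable (\<lambda>z. rec_nat (g z) (h z) (b z))"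
proof -
  obtain pg ph where pg: "\<And>z. \<exists>t. runs pg z (g z) t"
    and ph: "\<And>w. \<exists>t. runs ph w (h (p1 w) (p1 (p2 w)) (p2 (p2 w))) t"
    using g h unfolding computable_def by meson
  have "\<exists>t. runs (Prec pg ph) (prod_encode (z, n)) (rec_nat (g z) (h z) n) t" for z n
  proof (induction n)
    case 0 then show ?case using pg runs_Prec_0 by (metis old.nat.simps(6))
  next
    case (Suc n)
    then obtain t where t: "runs (Prec pg ph) (prod_encode (z, n)) (rec_nat (g z) (h z) n) t" by blast
    obtain u where "runs ph (prod_encode (z, prod_encode (n, rec_nat (g z) (h z) n)))
        (h z n (rec_nat (g z) (h z) n)) u"
      using ph[of "prod_encode (z, prod_encode (n, rec_nat (g z) (h z) n))"] by auto
    from runs_Prec_Suc[OF t this] show ?case by auto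
  qed
  then have "computable (\<lambda>w. rec_nat (g (p1 w)) (h (p1 w)) (p2 w))"
    by (intro computableI[of "Prec pg ph"]) (metis prod.collapse prod_decode_inverse)
  from comp_comp[OF this, of "\<lambda>z. prod_encode (z, b z)"] b show ?thesis
    by (simp add: comp_pair comp_id)
qed

lemma comp_funpow:
  assumes b: "computable b" and g: "computable g"
    and h: "computable (\<lambda>w. h (p1 w) (p2 w))"
  shows "computable (\<lambda>z. (h z ^^ b z) (g z))"
proof -
  have "(h z ^^ n) a = rec_nat a (\<lambda>_ r. h z r) n" for z n a by (induction n) auto
  moreover have "computable (\<lambda>w. h (p1 w) (p2 (p2 w)))"
    using comp_comp[OF h, of "\<lambda>w. prod_encode (p1 w, p2 (p2 w))"]
    by (simp add: comp)
  ultimately show ?thesis by (simp add: comp_rec b g)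
qed

lemma comp_funpow' [comp]:
  assumes b: "computable b" and g: "computable g" and h: "computable h"
  shows "computable (\<lambda>z. (h ^^ b z) (g z))"
  by (rule comp_funpow[OF b g]) (rule comp_comp[OF h]; intro comp)

lemma comp_case_nat [comp]:
  assumes "computable b" "computable g" "computable (\<lambda>w. h (p1 w) (p2 w))"
  shows "computable (\<lambda>z. case_nat (g z) (h z) (b z))"
proof -
  have "case_nat a f n = rec_nat a (\<lambda>n r. f n) n" for a n and f :: "nat \<Rightarrow> nat" by (cases n) auto
  moreover have "computable (\<lambda>w. h (p1 w) (p1 (p2 w)))"
    using comp_comp[OF assms(3), of "\<lambda>w. prod_encode (p1 w, p1 (p2 w))"] by (simp add: comp)
  ultimately show ?thesis by (simp add: comp_rec assms)
qed

lemma comp_add [comp]: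
  assumes "computable f" "computable g" shows "computable (\<lambda>z. f z + g z)"
proof -
  have "computable (\<lambda>z. rec_nat (f z) (\<lambda>_ r. Suc r) (g z))" by (intro comp assms)
  moreover have "rec_nat a (\<lambda>_ r. Suc r) b = a + b" for a b by (induction b) auto
  ultimately show ?thesis by simp
qed

lemma comp_mult [comp]:
  assumes "computable f" "computable g" shows "computable (\<lambda>z. f z * g z)"
proof -
  have "computable (\<lambda>z. rec_nat 0 (\<lambda>_ r. f z + r) (g z))"
    by (intro comp assms(2) comp_comp[OF assms(1)])
  moreover have "rec_nat 0 (\<lambda>_ r. a + r) b = a * b" for a b by (induction b) auto
  ultimately show ?thesis by simp
qed

lemma comp_pred [comp]:
  assumes "computable f" shows "computable (\<lambda>z. f z - 1)"
proof -
  have "computable (\<lambda>z. case f z of 0 \<Rightarrow> 0 | Suc n \<Rightarrow> n)" by (intro comp assms)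
  moreover have "(case a of 0 \<Rightarrow> 0 | Suc n \<Rightarrow> n) = a - 1" for a by (cases a) auto
  ultimately show ?thesis by simp
qed

lemma comp_diff [comp]:
  assumes "computable f" "computable g" shows "computable (\<lambda>z. f z - g z)"
proof -
  have "computable (\<lambda>z. rec_nat (f z) (\<lambda>_ r. r - 1) (g z))" by (intro comp assms)
  moreover have "rec_nat a (\<lambda>_ r. r - 1) b = a - b" for a b :: nat by (induction b) auto
  ultimately show ?thesis by simp
qed

lemma comp_if [comp]:
  assumes "decidable P" "computable f" "computable g"
  shows "computable (\<lambda>z. if P z then f z else g z)"
proof -
  have "computable (\<lambda>z. of_bool (P z) * f z + (1 - of_bool (P z)) * g z)"
    by (intro comp assms(2,3) assms(1)[unfolded decidable_def])
  moreover have "of_bool b * x + (1 - of_bool b) * y = (if b then x else y)" for b and x y :: nat by simp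
  ultimately show ?thesis by simp
qed

lemma comp_of_bool [comp]: "decidable P \<Longrightarrow> computable (\<lambda>z. of_bool (P z))"
  by (simp add: decidable_def)

lemma dec_not [comp]: "decidable P \<Longrightarrow> decidable (\<lambda>z. \<not> P z)"
proof -
  assume "decidable P"
  then have "computable (\<lambda>z. 1 - of_bool (P z))" by (intro comp)
  moreover have "1 - of_bool b = (of_bool (\<not> b) :: nat)" for b by simp
  ultimately show ?thesis by (simp only: decidable_def)
qed

lemma dec_conj [comp]: "decidable P \<Longrightarrow> decidable R \<Longrightarrow> decidable (\<lambda>z. P z \<and> R z)"
  unfolding decidable_def of_bool_conj by (rule comp_mult)

lemma dec_disj [comp]: "decidable P \<Longrightarrow> decidable R \<Longrightarrow> decidable (\<lambda>z. P z \<or> R z)"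
  using dec_not[OF dec_conj[OF dec_not dec_not]] by simp

lemma dec_imp [comp]: "decidable P \<Longrightarrow> decidable R \<Longrightarrow> decidable (\<lambda>z. P z \<longrightarrow> R z)"
  unfolding imp_conv_disj by (intro comp)

lemma dec_iff [comp]: "decidable P \<Longrightarrow> decidable R \<Longrightarrow> decidable (\<lambda>z. P z \<longleftrightarrow> R z)"
  using dec_conj[OF dec_imp dec_imp, of P R R P] by (simp add: iff_conv_conj_imp)

lemma dec_const [comp]: "decidable (\<lambda>z. c)"
  unfolding decidable_def by (rule comp_const)

lemma dec_zero:
  assumes "computable f" shows "decidable (\<lambda>z. f z = 0)"
proof -
  have "computable (\<lambda>z. 1 - f z)" by (intro comp assms)
  moreover have "1 - n = of_bool (n = 0)" for n :: nat by (cases n) auto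
  ultimately show ?thesis by (simp add: decidable_def)
qed

lemma dec_le [comp]: "computable f \<Longrightarrow> computable g \<Longrightarrow> decidable (\<lambda>z. f z \<le> g z)"
  using dec_zero[OF comp_diff, of f g] by simp

lemma dec_less [comp]: "computable f \<Longrightarrow> computable g \<Longrightarrow> decidable (\<lambda>z. f z < g z)"
  using dec_not[OF dec_le, of g f] by (simp add: not_le)

lemma dec_eq [comp]:
  assumes "computable f" "computable g" shows "decidable (\<lambda>z. f z = g z)"
proof -
  have "decidable (\<lambda>z. f z \<le> g z \<and> g z \<le> f z)" by (intro comp assms)
  then show ?thesis by (simp add: eq_iff)
qed

lemma dec_comp: "decidable P \<Longrightarrow> computable g \<Longrightarrow> decidable (\<lambda>z. P (g z))"
  unfolding decidable_def by (rule comp_comp)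

lemma dec_ex_less [comp]:
  assumes "computable b" "decidable (\<lambda>w. P (p1 w) (p2 w))"
  shows "decidable (\<lambda>z. \<exists>y<b z. P z y)"
proof -
  have "decidable (\<lambda>w. P (p1 w) (p1 (p2 w)))"
    using dec_comp[OF assms(2), of "\<lambda>w. prod_encode (p1 w, p1 (p2 w))"] by (simp add: comp)
  then have "computable (\<lambda>z. rec_nat 0 (\<lambda>y r. of_bool (P z y \<or> r = 1)) (b z))"
    by (intro comp assms(1))
  moreover have "rec_nat 0 (\<lambda>y r. of_bool (P z y \<or> r = 1)) n = (of_bool (\<exists>y<n. P z y) :: nat)" for z n
    by (induction n) (auto simp: less_Suc_eq)
  ultimately show ?thesis by (simp only: decidable_def)
qed

lemma dec_all_less [comp]:
  assumes "computable b" "decidable (\<lambda>w. P (p1 w) (p2 w))"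
  shows "decidable (\<lambda>z. \<forall>y<b z. P z y)"
  using dec_not[OF dec_ex_less[OF assms(1) dec_not[OF assms(2)]]] by simp

lemma dec_all_le [comp]:
  assumes "computable b" "decidable (\<lambda>w. P (p1 w) (p2 w))"
  shows "decidable (\<lambda>z. \<forall>y\<le>b z. P z y)"
  using dec_all_less[of "\<lambda>z. Suc (b z)" P, OF comp_Suc] assms by (simp add: less_Suc_eq_le)

lemma comp_div2 [comp]:
  assumes "computable f" shows "computable (\<lambda>z. f z div 2)"
proof -
  have "computable (\<lambda>z. rec_nat 0 (\<lambda>n r. n - r) (f z))" by (intro comp assms)
  \<comment> \<open>The recursion rests on \<open>n div 2 + Suc n div 2 = n\<close>.\<close>
  moreover have "rec_nat 0 (\<lambda>n r. n - r) n = n div 2" for n :: nat by (induction n) auto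
  ultimately show ?thesis by simp
qed

lemma comp_mod2 [comp]:
  assumes "computable f" shows "computable (\<lambda>z. f z mod 2)"
proof -
  have "computable (\<lambda>z. f z - 2 * (f z div 2))" by (intro comp assms)
  then show ?thesis by (simp add: modulo_nat_def mult.commute)
qed

lemma dec_even [comp]: "computable f \<Longrightarrow> decidable (\<lambda>z. even (f z))"
  unfolding even_iff_mod_2_eq_zero by (intro comp)

lemma comp_div4 [comp]: "computable f \<Longrightarrow> computable (\<lambda>z. f z div 4)"
  using comp_div2[OF comp_div2, of f] by (simp flip: div_mult2_eq)

lemma comp_mod4 [comp]:
  assumes "computable f" shows "computable (\<lambda>z. f z mod 4)"
proof -
  have "computable (\<lambda>z. f z - 4 * (f z div 4))" by (intro comp assms)
  then show ?thesis by (simp add: modulo_nat_def mult.commute)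
qed

lemma comp_power2 [comp]:
  assumes "computable f" shows "computable (\<lambda>z. 2 ^ f z)"
proof -
  have "computable (\<lambda>z. rec_nat 1 (\<lambda>_ r. 2 * r) (f z))" by (intro comp assms)
  moreover have "rec_nat 1 (\<lambda>_ r. 2 * r) n = (2 :: nat) ^ n" for n by (induction n) auto
  ultimately show ?thesis by simp
qed

lemma dec_set_decode [comp]:
  assumes "computable f" "computable g" shows "decidable (\<lambda>z. f z \<in> set_decode (g z))"
proof -
  have "decidable (\<lambda>z. odd (((\<lambda>n. n div 2) ^^ f z) (g z)))" by (intro comp assms)
  moreover have "((\<lambda>n. n div 2) ^^ k) n = n div 2 ^ k" for k n :: nat
    by (induction k) (auto simp: div_mult2_eq[symmetric] mult.commute)
  ultimately show ?thesis by (simp add: set_decode_def)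
qed

lemma comp_sum [comp]:
  assumes "computable b" "computable (\<lambda>w. f (p1 w) (p2 w))"
  shows "computable (\<lambda>z. \<Sum>y<b z. f z y)"
proof -
  have "computable (\<lambda>w. f (p1 w) (p1 (p2 w)))"
    using comp_comp[OF assms(2), of "\<lambda>w. prod_encode (p1 w, p1 (p2 w))"] by (simp add: comp)
  then have "computable (\<lambda>z. rec_nat 0 (\<lambda>y r. f z y + r) (b z))"
    by (intro comp assms(1))
  moreover have "rec_nat 0 (\<lambda>y r. f z y + r) n = (\<Sum>y<n. f z y)" for z n
    by (induction n) (auto simp: add.commute)
  ultimately show ?thesis by simp
qed

text \<open>A test that is zero exactly where \<open>R\<close> holds turns \<open>Mu\<close> into a
  search. This serves both for computable functions and for c.e. sets, as domains of
  programs.\<close>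

lemma Mu_runs:
  assumes "decidable (\<lambda>w. R (p1 w) (p2 w))"
  obtains q where "\<And>z n. R z n \<Longrightarrow> \<exists>t. runs (Mu q) z (LEAST n. R z n) t"
    and "\<And>z y t. runs (Mu q) z y t \<Longrightarrow> \<exists>n. R z n"
proof -
  have "computable (\<lambda>w. 1 - of_bool (R (p1 w) (p2 w)))" by (intro comp assms)
  then obtain q where q: "\<And>w. \<exists>t. runs q w (1 - of_bool (R (p1 w) (p2 w))) t"
    unfolding computable_def by blast
  have q': "\<exists>t. runs q (prod_encode (z, j)) (1 - of_bool (R z j)) t" for z j
    using q[of "prod_encode (z, j)"] by simp
  have "\<exists>t. runs (Mu q) z (LEAST n. R z n) t" if "R z n" for z n
  proof -
    let ?m = "LEAST n. R z n"
    obtain t where t: "\<And>j. runs q (prod_encode (z, j)) (1 - of_bool (R z j)) (t j)"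
      using q' by metis
    have "runs q (prod_encode (z, j)) (Suc 0) (t j)" if "j < ?m" for j
      using t[of j] not_less_Least[OF that] by simp
    moreover have "runs q (prod_encode (z, ?m)) 0 (t ?m)"
      using t[of ?m] LeastI[of "R z", OF that] by simp
    ultimately show ?thesis using runs_Mu[of ?m q z "\<lambda>_. 0" t] by auto
  qed
  moreover have "\<exists>n. R z n" if r: "runs (Mu q) z y t" for z y t
  proof -
    from r have "\<exists>t. runs q (prod_encode (z, y)) 0 t" by cases auto
    moreover obtain t where "runs q (prod_encode (z, y)) (1 - of_bool (R z y)) t"
      using q' by blast
    ultimately have "1 - of_bool (R z y) = (0::nat)" using runs_fun by blast
    then show ?thesis by (cases "R z y") auto
  qed
  ultimately show ?thesis using that by blast
qed

lemma comp_Least: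
  assumes "decidable (\<lambda>w. R (p1 w) (p2 w))" "\<And>z. \<exists>n. R z n"
  shows "computable (\<lambda>z. LEAST n. R z n)"
  using Mu_runs[OF assms(1)] assms(2) unfolding computable_def by metis

lemma W_code: "W (code p) = {x. \<exists>y t. runs p x y t}"
  using inj_code unfolding W_def inj_def by auto

lemma semidecidable:
  assumes "decidable (\<lambda>w. R (p1 w) (p2 w))"
  obtains e where "W e = {z. \<exists>u. R z u}"
proof -
  obtain q where "\<And>z n. R z n \<Longrightarrow> \<exists>t. runs (Mu q) z (LEAST n. R z n) t"
    and "\<And>z y t. runs (Mu q) z y t \<Longrightarrow> \<exists>n. R z n"
    using Mu_runs[OF assms] by blast
  then have "W (code (Mu q)) = {z. \<exists>u. R z u}" unfolding W_code by blast
  then show ?thesis by (rule that)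
qed

lemma ceI:
  assumes "decidable (\<lambda>w. R (p1 w) (p2 w))"
  shows "ce {z. \<exists>u. R z u}"
  using semidecidable[OF assms] unfolding ce_def by metis

section \<open>A universal machine\<close>

datatype frame = Run prog | Pair1 prog nat | Pair2 nat | PrecK prog nat nat | MuK prog nat nat

text \<open>A configuration consists of the stack of pending work, the current value and a clock, which
  ticks only when a \<open>Run\<close> frame is popped, so that it counts the steps of \<^const>\<open>runs\<close>.\<close>

fun step :: "frame list \<times> nat \<times> nat \<Rightarrow> frame list \<times> nat \<times> nat" where
  "step ([], v, c) = ([], v, c)"
| "step (Run Zero # K, v, c) = (K, 0, Suc c)"
| "step (Run Succ # K, v, c) = (K, Suc v, Suc c)"
| "step (Run Fst # K, v, c) = (K, p1 v, Suc c)"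
| "step (Run Snd # K, v, c) = (K, p2 v, Suc c)"
| "step (Run (Pair p q) # K, v, c) = (Run p # Pair1 q v # K, v, Suc c)"
| "step (Run (Comp p q) # K, v, c) = (Run q # Run p # K, v, Suc c)"
| "step (Run (Prec p q) # K, v, c) =
    (if p2 v = 0 then (Run p # K, p1 v, Suc c)
     else (Run (Prec p q) # PrecK q (p1 v) (p2 v - 1) # K, prod_encode (p1 v, p2 v - 1), Suc c))"
| "step (Run (Mu p) # K, v, c) = (Run p # MuK p v 0 # K, prod_encode (v, 0), Suc c)"
| "step (Pair1 q x # K, v, c) = (Run q # Pair2 v # K, x, c)"
| "step (Pair2 y # K, v, c) = (K, prod_encode (y, v), c)"
| "step (PrecK q a n # K, v, c) = (Run q # K, prod_encode (a, prod_encode (n, v)), c)"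
| "step (MuK p a j # K, v, c) =
    (if v = 0 then (K, j, c) else (Run p # MuK p a (Suc j) # K, prod_encode (a, Suc j), c))"

lemma step_empty: "(step ^^ n) ([], v, c) = ([], v, c)"
  by (induction n) auto

lemma funpow_trans: "(f ^^ n) x = y \<Longrightarrow> (f ^^ m) y = z \<Longrightarrow> (f ^^ (n + m)) x = z"
  by (simp add: add.commute[of n] funpow_add)

lemma funpow_1: "(f ^^ Suc n) x = (f ^^ n) (f x)"
  by (simp add: funpow_swap1)

abbreviation steps :: "nat \<Rightarrow> frame list \<times> nat \<times> nat \<Rightarrow> frame list \<times> nat \<times> nat \<Rightarrow> bool" where
  "steps n c c' \<equiv> (step ^^ n) c = c'"

lemma steps_Suc: "steps n (step c) c' \<Longrightarrow> steps (Suc n) c c'"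
  by (simp add: funpow_swap1)

text \<open>The linear bound lets a fixed number of steps decide membership in a stage. It is strict
  so that each subcomputation leaves one step over to pay for the frame handled after it.\<close>

lemma machine_complete:
  "runs p x y t \<Longrightarrow> \<exists>n<4*t. \<forall>K c. steps n (Run p # K, x, c) (K, y, c + t)"
proof (induction rule: runs.induct)
  case (runs_Zero x) show ?case by (rule exI[of _ 1]) simp
next
  case (runs_Succ x) show ?case by (rule exI[of _ 1]) simp
next
  case (runs_Fst a b) show ?case by (rule exI[of _ 1]) simp
next
  case (runs_Snd a b) show ?case by (rule exI[of _ 1]) simp
next
  case (runs_Pair p x y t q z u)
  then obtain n m where n: "n < 4*t" "\<And>K c. steps n (Run p # K, x, c) (K, y, c + t)"
    and m: "m < 4*u" "\<And>K c. steps m (Run q # K, x, c) (K, z, c + u)" by blast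
  have "steps (Suc (n + Suc (m + 1))) (Run (Pair p q) # K, x, c)
      (K, prod_encode (y, z), c + Suc (t + u))" for K c
  proof -
    have "steps (m + 1) (Run q # Pair2 y # K, x, Suc c + t) (K, prod_encode (y, z), Suc c + t + u)"
      by (rule funpow_trans[OF m(2)]) simp
    then have "steps (Suc (m + 1)) (Pair1 q x # K, y, Suc c + t) (K, prod_encode (y, z), Suc c + t + u)"
      by (intro steps_Suc) simp
    from funpow_trans[OF n(2) this]
    have "steps (n + Suc (m + 1)) (step (Run (Pair p q) # K, x, c)) (K, prod_encode (y, z), Suc c + t + u)"
      by simp
    then show ?thesis using steps_Suc by (metis add_Suc add_Suc_right add.assoc)
  qed
  moreover have "Suc (n + Suc (m + 1)) < 4 * Suc (t + u)" using n(1) m(1) by simp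
  ultimately show ?case by blast
next
  case (runs_Comp q x y t p z u)
  then obtain n m where n: "n < 4*t" "\<And>K c. steps n (Run q # K, x, c) (K, y, c + t)"
    and m: "m < 4*u" "\<And>K c. steps m (Run p # K, y, c) (K, z, c + u)" by blast
  have "steps (Suc (n + m)) (Run (Comp p q) # K, x, c) (K, z, c + Suc (t + u))" for K c
    using funpow_trans[OF n(2) m(2), of K "Suc c"] by (simp add: funpow_1 add.assoc del: funpow.simps)
  moreover have "Suc (n + m) < 4 * Suc (t + u)" using n(1) m(1) by simp
  ultimately show ?case by blast
next
  case (runs_Prec_0 p a y t q)
  then obtain n where n: "n < 4*t" "\<And>K c. steps n (Run p # K, a, c) (K, y, c + t)" by blast
  have "steps (Suc n) (Run (Prec p q) # K, prod_encode (a, 0), c) (K, y, c + Suc t)" for K c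
    using n(2)[of K "Suc c"] by (simp add: funpow_1 del: funpow.simps)
  moreover have "Suc n < 4 * Suc t" using n(1) by simp
  ultimately show ?case by blast
next
  case (runs_Prec_Suc p q a n r t y u)
  then obtain i m where n: "i < 4*t"
      "\<And>K c. steps i (Run (Prec p q) # K, prod_encode (a, n), c) (K, r, c + t)"
    and m: "m < 4*u"
      "\<And>K c. steps m (Run q # K, prod_encode (a, prod_encode (n, r)), c) (K, y, c + u)" by blast
  have "steps (Suc (i + Suc m)) (Run (Prec p q) # K, prod_encode (a, Suc n), c)
      (K, y, c + Suc (t + u))" for K c
  proof -
    have "steps (Suc m) (PrecK q a n # K, r, Suc c + t) (K, y, Suc c + t + u)"
      by (rule steps_Suc) (simp add: m(2)[of _ "Suc c + t", simplified])
    from funpow_trans[OF n(2) this]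
    have "steps (i + Suc m) (step (Run (Prec p q) # K, prod_encode (a, Suc n), c)) (K, y, Suc c + t + u)"
      by simp
    then show ?thesis using steps_Suc by (metis add_Suc add_Suc_right add.assoc)
  qed
  moreover have "Suc (i + Suc m) < 4 * Suc (t + u)" using n(1) m(1) by simp
  ultimately show ?case by blast
next
  case (runs_Mu m p a v t)
  have ex: "\<exists>n<4*t j. \<forall>K c. steps n (Run p # K, prod_encode (a, j), c)
      (K, if j = m then 0 else Suc (v j), c + t j)" if "j \<le> m" for j
    using runs_Mu.IH that by (cases "j = m") auto
  \<comment> \<open>The trials are added up backwards from the last one; the bound is no longer
    strict because the \<open>MuK\<close> frames are included.\<close>
  have "\<exists>n\<le>4 * (\<Sum>i\<in>{j..m}. t i). \<forall>K c. steps n (Run p # MuK p a j # K, prod_encode (a, j), c)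
      (K, m, c + (\<Sum>i\<in>{j..m}. t i))" if "j \<le> m" for j
    using that
  proof (induction rule: inc_induct)
    case base
    obtain n where n: "n < 4 * t m" "\<And>K c. steps n (Run p # K, prod_encode (a, m), c) (K, 0, c + t m)"
      using ex[of m] by auto
    have "steps (n + 1) (Run p # MuK p a m # K, prod_encode (a, m), c) (K, m, c + t m)" for K c
      by (rule funpow_trans[OF n(2)]) simp
    moreover have "n + 1 \<le> 4 * t m" using n(1) by simp
    ultimately show ?case by auto
  next
    case (step j)
    obtain n where n: "n < 4 * t j"
        "\<And>K c. steps n (Run p # K, prod_encode (a, j), c) (K, Suc (v j), c + t j)"
      using ex[of j] step.hyps by auto
    obtain n' where n': "n' \<le> 4 * (\<Sum>i\<in>{Suc j..m}. t i)"
        "\<And>K c. steps n' (Run p # MuK p a (Suc j) # K, prod_encode (a, Suc j), c)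
          (K, m, c + (\<Sum>i\<in>{Suc j..m}. t i))"
      using step.IH by blast
    have s: "(\<Sum>i\<in>{j..m}. t i) = t j + (\<Sum>i\<in>{Suc j..m}. t i)"
      using step.hyps by (simp add: sum.atLeast_Suc_atMost)
    have "steps (n + Suc n') (Run p # MuK p a j # K, prod_encode (a, j), c)
        (K, m, c + (\<Sum>i\<in>{j..m}. t i))" for K c
      by (rule funpow_trans[OF n(2)], rule steps_Suc) (simp add: n'(2) s add.assoc)
    moreover have "n + Suc n' \<le> 4 * (\<Sum>i\<in>{j..m}. t i)" using n(1) n'(1) s by simp
    ultimately show ?case by blast
  qed
  from this[of 0] obtain n where n: "n \<le> 4 * (\<Sum>i\<in>{0..m}. t i)"
    "\<And>K c. steps n (Run p # MuK p a 0 # K, prod_encode (a, 0), c) (K, m, c + (\<Sum>i\<in>{0..m}. t i))"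
    by blast
  have "steps (Suc n) (Run (Mu p) # K, a, c) (K, m, c + Suc (\<Sum>j\<le>m. t j))" for K c
    by (rule steps_Suc) (simp add: n(2) atLeast0AtMost)
  moreover have "Suc n < 4 * Suc (\<Sum>j\<le>m. t j)" using n(1) by (simp add: atLeast0AtMost)
  ultimately show ?case by blast
qed

abbreviation halts :: "nat \<Rightarrow> frame list \<times> nat \<times> nat \<Rightarrow> nat \<times> nat \<Rightarrow> bool" where
  "halts n c r \<equiv> steps n c ([], r)"

lemma halts_step:
  assumes "halts n (f # K, v, c) r"
  obtains n' where "n = Suc n'" "halts n' (step (f # K, v, c)) r"
  using assms by (cases n) (auto simp: funpow_1 simp del: funpow.simps(2))

text \<open>Induction on the length of the halting computation: a subprogram must finish before the
  frame below it is reached, so each continuation starts with strictly fewer steps left.\<close>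

lemma machine_sound:
  "halts n (Run p # K, x, c) r \<Longrightarrow> \<exists>y t n'. runs p x y t \<and> n' < n \<and> halts n' (K, y, c + t) r"
proof (induction n arbitrary: p K x c rule: less_induct)
  case (less n)
  obtain n0 where n0: "n = Suc n0" "halts n0 (step (Run p # K, x, c)) r"
    using halts_step[OF less.prems] .
  note IH = less.IH
  show ?case
  proof (cases p)
    case Zero
    then show ?thesis using n0 runs_Zero[of x] by - (rule exI[of _ 0], rule exI[of _ 1], rule exI[of _ n0], simp)
  next
    case Succ
    then show ?thesis using n0 runs_Succ[of x] by - (rule exI[of _ "Suc x"], rule exI[of _ 1], rule exI[of _ n0], simp)
  next
    case Fst
    then show ?thesis using n0 runs_p1[of x] by - (rule exI[of _ "p1 x"], rule exI[of _ 1], rule exI[of _ n0], simp)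
  next
    case Snd
    then show ?thesis using n0 runs_p2[of x] by - (rule exI[of _ "p2 x"], rule exI[of _ 1], rule exI[of _ n0], simp)
  next
    case (Pair p' q)
    then have "halts n0 (Run p' # Pair1 q x # K, x, Suc c) r" using n0 by simp
    from IH[OF _ this] n0 obtain y t n1 where 1: "runs p' x y t" "n1 < n0"
      "halts n1 (Pair1 q x # K, y, Suc c + t) r" by auto
    obtain n2 where 2: "n1 = Suc n2" "halts n2 (Run q # Pair2 y # K, x, Suc c + t) r"
      using halts_step[OF 1(3)] by auto
    from IH[OF _ 2(2)] 1 2 n0 obtain z u n3 where 3: "runs q x z u" "n3 < n2"
      "halts n3 (Pair2 y # K, z, Suc c + t + u) r" by auto
    obtain n4 where 4: "n3 = Suc n4" "halts n4 (K, prod_encode (y, z), Suc c + t + u) r"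
      using halts_step[OF 3(3)] by auto
    have "runs p x (prod_encode (y, z)) (Suc (t + u))"
      unfolding Pair by (rule runs_Pair[OF 1(1) 3(1)])
    moreover have "n4 < n" using n0 1 2 3 4 by simp
    ultimately show ?thesis using 4 by (metis add_Suc add_Suc_right add.assoc)
  next
    case (Comp p' q)
    then have "halts n0 (Run q # Run p' # K, x, Suc c) r" using n0 by simp
    from IH[OF _ this] n0 obtain y t n1 where 1: "runs q x y t" "n1 < n0"
      "halts n1 (Run p' # K, y, Suc c + t) r" by auto
    from IH[OF _ 1(3)] 1 n0 obtain z u n3 where 3: "runs p' y z u" "n3 < n1"
      "halts n3 (K, z, Suc c + t + u) r" by auto
    have "runs p x z (Suc (t + u))"
      unfolding Comp by (rule runs_Comp[OF 1(1) 3(1)])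
    moreover have "n3 < n" using n0 1 3 by simp
    ultimately show ?thesis using 3 by (metis add_Suc add_Suc_right add.assoc)
  next
    case (Prec p' q)
    show ?thesis
    proof (cases "p2 x")
      case 0
      then have x: "x = prod_encode (p1 x, 0)" by (metis prod.collapse prod_decode_inverse)
      have "halts n0 (Run p' # K, p1 x, Suc c) r" using n0 Prec 0 by simp
      from IH[OF _ this] n0 obtain y t n1 where 1: "runs p' (p1 x) y t" "n1 < n0"
        "halts n1 (K, y, Suc c + t) r" by auto
      have "runs p x y (Suc t)" unfolding Prec by (subst x, rule runs_Prec_0[OF 1(1)])
      moreover have "n1 < n" using n0 1 by simp
      ultimately show ?thesis using 1 by (metis add_Suc add_Suc_right)
    next
      case (Suc m)
      then have x: "x = prod_encode (p1 x, Suc m)" by (metis prod.collapse prod_decode_inverse)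
      have "halts n0 (Run p # PrecK q (p1 x) m # K, prod_encode (p1 x, m), Suc c) r"
        using n0 Prec Suc by simp
      from IH[OF _ this] n0 obtain y t n1 where 1: "runs p (prod_encode (p1 x, m)) y t" "n1 < n0"
        "halts n1 (PrecK q (p1 x) m # K, y, Suc c + t) r" by auto
      obtain n2 where 2: "n1 = Suc n2"
        "halts n2 (Run q # K, prod_encode (p1 x, prod_encode (m, y)), Suc c + t) r"
        using halts_step[OF 1(3)] by auto
      from IH[OF _ 2(2)] 1 2 n0 obtain z u n3 where
        3: "runs q (prod_encode (p1 x, prod_encode (m, y))) z u" "n3 < n2"
        "halts n3 (K, z, Suc c + t + u) r" by auto
      have "runs p x z (Suc (t + u))"
        unfolding Prec by (subst x, rule runs_Prec_Suc[OF 1(1)[unfolded Prec] 3(1)])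
      moreover have "n3 < n" using n0 1 2 3 by simp
      ultimately show ?thesis using 3 by (metis add_Suc add_Suc_right add.assoc)
    qed
  next
    case (Mu q)
    \<comment> \<open>An inner induction follows the trials from \<open>j\<close> on and collects
      their values and running times until a zero appears.\<close>
    have loop: "\<exists>m vv tt n'. j \<le> m \<and> (\<forall>i. j \<le> i \<and> i < m \<longrightarrow> runs q (prod_encode (x, i)) (Suc (vv i)) (tt i))
        \<and> runs q (prod_encode (x, m)) 0 (tt m) \<and> n' < i \<and> halts n' (K, m, d + (\<Sum>i\<in>{j..m}. tt i)) r"
      if "i < n" "halts i (Run q # MuK q x j # K, prod_encode (x, j), d) r" for i j d
      using that
    proof (induction i arbitrary: j d rule: less_induct)
      case (less i)
      from IH[OF less.prems] obtain y t n1 where 1: "runs q (prod_encode (x, j)) y t" "n1 < i"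
        "halts n1 (MuK q x j # K, y, d + t) r" by auto
      obtain n2 where 2: "n1 = Suc n2" "halts n2 (step (MuK q x j # K, y, d + t)) r"
        using halts_step[OF 1(3)] .
      show ?case
      proof (cases y)
        case 0
        then show ?thesis using 1 2
          by - (rule exI[of _ j], rule exI[of _ "\<lambda>_. 0"], rule exI[of _ "\<lambda>_. t"], rule exI[of _ n2], auto)
      next
        case (Suc y')
        then have "halts n2 (Run q # MuK q x (Suc j) # K, prod_encode (x, Suc j), d + t) r"
          using 2 by simp
        moreover have "n2 < i" "n2 < n" using 1 2 less.prems by auto
        ultimately obtain m vv tt n' where 3: "Suc j \<le> m"
          "\<forall>i. Suc j \<le> i \<and> i < m \<longrightarrow> runs q (prod_encode (x, i)) (Suc (vv i)) (tt i)"
          "runs q (prod_encode (x, m)) 0 (tt m)" "n' < n2"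
          "halts n' (K, m, d + t + (\<Sum>i\<in>{Suc j..m}. tt i)) r"
          using less.IH[of n2 "Suc j" "d + t"] by blast
        let ?vv = "vv(j := y')" and ?tt = "tt(j := t)"
        have "(\<Sum>i\<in>{j..m}. ?tt i) = t + (\<Sum>i\<in>{Suc j..m}. ?tt i)"
          using 3(1) by (simp add: sum.atLeast_Suc_atMost)
        also have "(\<Sum>i\<in>{Suc j..m}. ?tt i) = (\<Sum>i\<in>{Suc j..m}. tt i)"
          by (rule sum.cong) auto
        finally have s: "(\<Sum>i\<in>{j..m}. ?tt i) = t + (\<Sum>i\<in>{Suc j..m}. tt i)" .
        have "halts n' (K, m, d + (\<Sum>i\<in>{j..m}. ?tt i)) r"
          unfolding s using 3(5) by (simp add: add.assoc)
        moreover have "runs q (prod_encode (x, m)) 0 (?tt m)" "n' < i" "j \<le> m"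
          using 3 \<open>n2 < i\<close> by auto
        moreover have "\<forall>i. j \<le> i \<and> i < m \<longrightarrow> runs q (prod_encode (x, i)) (Suc (?vv i)) (?tt i)"
        proof (intro allI impI)
          fix i' assume "j \<le> i' \<and> i' < m"
          then show "runs q (prod_encode (x, i')) (Suc (?vv i')) (?tt i')"
            using 3(2) 1(1) Suc by (cases "i' = j") auto
        qed
        ultimately show ?thesis by blast
      qed
    qed
    have "halts n0 (Run q # MuK q x 0 # K, prod_encode (x, 0), Suc c) r" using n0 Mu by simp
    from loop[OF _ this] n0 obtain m vv tt n' where
      3: "\<forall>i. i < m \<longrightarrow> runs q (prod_encode (x, i)) (Suc (vv i)) (tt i)"
      "runs q (prod_encode (x, m)) 0 (tt m)" "n' < n0"
      "halts n' (K, m, Suc c + (\<Sum>i\<in>{0..m}. tt i)) r" by auto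
    have "runs p x m (Suc (\<Sum>i\<le>m. tt i))"
      unfolding Mu by (rule runs_Mu[OF 3(1,2)])
    moreover have "n' < n" using n0 3 by simp
    ultimately show ?thesis using 3(4) by (metis add_Suc add_Suc_right atLeast0AtMost)
  qed
qed

text \<open>A halted configuration no longer changes, so \<open>4 * s\<close> steps can be taken in
  every case; the clock then shows the running time.\<close>

lemma W_at_machine:
  "x \<in> W_at (code p) s \<longleftrightarrow>
     x < s \<and> (\<exists>y c. halts (4 * s) ([Run p], x, 0) (y, c) \<and> c < s)"
proof
  assume "x \<in> W_at (code p) s"
  then obtain y t where xt: "x < s" "t < s" and r: "runs p x y t"
    unfolding W_at_def using inj_code unfolding inj_def by auto
  obtain n where n: "n < 4 * t" "steps n (Run p # [], x, 0) ([], y, 0 + t)"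
    using machine_complete[OF r] by blast
  have "halts (n + (4 * s - n)) ([Run p], x, 0) (y, t)"
    using n(2) by (intro funpow_trans[OF _ step_empty]) simp
  then show "x < s \<and> (\<exists>y c. halts (4 * s) ([Run p], x, 0) (y, c) \<and> c < s)"
    using xt n(1) by auto
next
  assume a: "x < s \<and> (\<exists>y c. halts (4 * s) ([Run p], x, 0) (y, c) \<and> c < s)"
  then obtain y c where "halts (4 * s) ([Run p], x, 0) (y, c)" and c: "c < s" by blast
  from machine_sound[OF this(1)] obtain y' t n' where "runs p x y' t" "halts n' ([], y', t) (y, c)"
    by auto
  then have "runs p x y c" by (simp add: step_empty)
  then show "x \<in> W_at (code p) s" using a c unfolding W_at_def by blast
qed

section \<open>Arithmetisation of the machine\<close>

primrec enc_frame :: "frame \<Rightarrow> nat" where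
  "enc_frame (Run p) = prod_encode (0, code p)"
| "enc_frame (Pair1 q x) = prod_encode (1, prod_encode (code q, x))"
| "enc_frame (Pair2 y) = prod_encode (2, y)"
| "enc_frame (PrecK q a n) = prod_encode (3, prod_encode (code q, prod_encode (a, n)))"
| "enc_frame (MuK p a j) = prod_encode (4, prod_encode (code p, prod_encode (a, j)))"

text \<open>The successor keeps 0 free for the empty stack.\<close>

definition push :: "nat \<Rightarrow> nat \<Rightarrow> nat" where
  "push f K = Suc (prod_encode (f, K))"

primrec enc_stack :: "frame list \<Rightarrow> nat" where
  "enc_stack [] = 0"
| "enc_stack (f # K) = push (enc_frame f) (enc_stack K)"

definition conf :: "nat \<Rightarrow> nat \<Rightarrow> nat \<Rightarrow> nat" where
  "conf K v c = prod_encode (K, prod_encode (v, c))"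

definition enc :: "frame list \<times> nat \<times> nat \<Rightarrow> nat" where
  "enc = (\<lambda>(K, v, c). conf (enc_stack K) v c)"

text \<open>Below, \<open>e\<close> is the code of the program to be run and \<open>d\<close> the data of a frame; the code of a
  program that is built from two others is \<open>4 * prod_encode (a, b) + 4 + r\<close> with \<open>r < 3\<close>.\<close>

definition run_step :: "nat \<Rightarrow> nat \<Rightarrow> nat \<Rightarrow> nat \<Rightarrow> nat" where
  "run_step e K v c =
    (if e = 0 then conf K 0 (c + 1) else if e = 1 then conf K (v + 1) (c + 1)
     else if e = 2 then conf K (p1 v) (c + 1) else if e = 3 then conf K (p2 v) (c + 1)
     else if e mod 4 = 0 then
       conf (push (prod_encode (0, p1 ((e - 4) div 4)))
              (push (prod_encode (1, prod_encode (p2 ((e - 4) div 4), v))) K)) v (c + 1)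
     else if e mod 4 = 1 then
       conf (push (prod_encode (0, p2 ((e - 4) div 4)))
              (push (prod_encode (0, p1 ((e - 4) div 4))) K)) v (c + 1)
     else if e mod 4 = 2 then
       (if p2 v = 0 then conf (push (prod_encode (0, p1 ((e - 4) div 4))) K) (p1 v) (c + 1)
        else conf (push (prod_encode (0, e))
               (push (prod_encode (3, prod_encode (p2 ((e - 4) div 4), prod_encode (p1 v, p2 v - 1)))) K))
               (prod_encode (p1 v, p2 v - 1)) (c + 1))
     else conf (push (prod_encode (0, (e - 4) div 4))
            (push (prod_encode (4, prod_encode ((e - 4) div 4, prod_encode (v, 0)))) K))
            (prod_encode (v, 0)) (c + 1))"

definition frame_step :: "nat \<Rightarrow> nat \<Rightarrow> nat \<Rightarrow> nat \<Rightarrow> nat \<Rightarrow> nat" where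
  "frame_step i d K v c =
    (if i = 0 then run_step d K v c
     else if i = 1 then conf (push (prod_encode (0, p1 d)) (push (prod_encode (2, v)) K)) (p2 d) c
     else if i = 2 then conf K (prod_encode (d, v)) c
     else if i = 3 then conf (push (prod_encode (0, p1 d)) K)
       (prod_encode (p1 (p2 d), prod_encode (p2 (p2 d), v))) c
     else if v = 0 then conf K (p2 (p2 d)) c
     else conf (push (prod_encode (0, p1 d))
            (push (prod_encode (4, prod_encode (p1 d, prod_encode (p1 (p2 d), p2 (p2 d) + 1)))) K))
            (prod_encode (p1 (p2 d), p2 (p2 d) + 1)) c)"

definition nstep :: "nat \<Rightarrow> nat" where
  "nstep z = (if p1 z = 0 then z else
     frame_step (p1 (p1 (p1 z - 1))) (p2 (p1 (p1 z - 1))) (p2 (p1 z - 1)) (p1 (p2 z)) (p2 (p2 z)))"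

lemma code_mod: "(4 * n + 5) mod 4 = (1 :: nat)"
    "(4 * n + 6) mod 4 = (2 :: nat)" "(4 * n + 7) mod 4 = (3 :: nat)"
  by presburger+

lemma code_div: "Suc (4 * n) div 4 = n" "Suc (Suc (4 * n)) div 4 = n" "(3 + 4 * n) div 4 = n"
  by presburger+

lemma nstep_enc: "nstep (enc c) = enc (step c)"
proof -
  have *: "nstep (conf (push (prod_encode (i, d)) K) v c) = frame_step i d K v c" for i d K v c
    by (simp add: nstep_def conf_def push_def)
  have "nstep (conf 0 v c) = conf 0 v c" for v c by (simp add: nstep_def conf_def)
  then show ?thesis
    by (cases c rule: step.cases)
      (simp_all add: enc_def * frame_step_def run_step_def code_mod code_div)
qed

lemma comp_nstep: "computable nstep"
  unfolding nstep_def frame_step_def run_step_def conf_def push_def by (intro comp)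

text \<open>This is what the universal machine serves for: index and stage may themselves be
  computed, as they are throughout the construction.\<close>

lemma dec_W_at [comp]:
  assumes "computable f" "computable e" "computable s"
  shows "decidable (\<lambda>z. f z \<in> W_at (e z) (s z))"
proof -
  let ?z0 = "\<lambda>e x. prod_encode (Suc (prod_encode (prod_encode (0, e), 0)), prod_encode (x, 0))"
  have dec: "decidable (\<lambda>z. f z < s z \<and> p1 ((nstep ^^ (4 * s z)) (?z0 (e z) (f z))) = 0 \<and>
      p2 (p2 ((nstep ^^ (4 * s z)) (?z0 (e z) (f z)))) < s z)"
    by (intro comp assms comp_nstep)
  have it: "(nstep ^^ n) (enc c) = enc ((step ^^ n) c)" for n c
    by (induction n) (auto simp: nstep_enc)
  have "x \<in> W_at i t \<longleftrightarrow> x < t \<and> p1 ((nstep ^^ (4 * t)) (?z0 i x)) = 0 \<and>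
      p2 (p2 ((nstep ^^ (4 * t)) (?z0 i x))) < t" for x i t
  proof -
    obtain p where i: "i = code p" using surj_code by metis
    have z0: "?z0 i x = enc ([Run p], x, 0)" by (simp add: i enc_def conf_def push_def)
    obtain K y c where c: "(step ^^ (4 * t)) ([Run p], x, 0) = (K, y, c)" by (metis prod_cases3)
    have "p1 (enc (K, y, c)) = 0 \<longleftrightarrow> K = []" "p2 (p2 (enc (K, y, c))) = c"
      by (cases K; simp add: enc_def conf_def push_def)+
    then show ?thesis unfolding z0 it c unfolding i W_at_machine c by auto
  qed
  then show ?thesis using dec by simp
qed

section \<open>Closure properties of the c.e. sets\<close>

lemma dec_X_nce_at [comp]:
  "computable f \<Longrightarrow> computable e \<Longrightarrow> computable s \<Longrightarrow> decidable (\<lambda>z. f z \<in> X_nce_at n (e z) (s z))"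
proof (induction n arbitrary: e rule: induct_nat_012)
  case 0
  then show ?case by (simp add: X_nce_at_def comp)
next
  case 1
  then show ?case by (simp add: X_nce_at_def comp)
next
  case (ge2 n)
  show ?case
  proof (cases n)
    case 0
    have "decidable (\<lambda>z. f z \<in> W_at (p1 (e z)) (s z) \<and> f z \<notin> W_at (p2 (e z)) (s z))"
      by (intro comp ge2.prems)
    then show ?thesis by (simp add: 0 X_nce_at_def)
  next
    case (Suc n')
    have "decidable (\<lambda>z. (f z \<in> W_at (p1 (e z)) (s z) \<and> f z \<notin> W_at (p1 (p2 (e z))) (s z)) \<or>
        f z \<in> X_nce_at n (p2 (p2 (e z))) (s z))"
      by (intro comp ge2)
    then show ?thesis by (simp add: Suc X_nce_at_def)
  qed
qed

section \<open>Canonical indices of finite sets\<close>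

lemma set_decode_sum: "i \<in> set_decode (\<Sum>e<n. of_bool (P e) * 2 ^ e) \<longleftrightarrow> i < n \<and> P i"
proof -
  have "(\<Sum>e<n. of_bool (P e) * 2 ^ e) = (\<Sum>e\<in>{e. e < n \<and> P e}. (2::nat) ^ e)"
    by (rule sum.mono_neutral_cong_right) auto
  also have "\<dots> = set_encode {e. e < n \<and> P e}" by (simp add: set_encode_def)
  finally show ?thesis by simp
qed

lemma set_decode_bound: "i \<in> set_decode a \<Longrightarrow> a < 2 ^ n \<Longrightarrow> i < n"
proof (rule ccontr)
  assume "i \<in> set_decode a" "a < 2 ^ n" "\<not> i < n"
  then have "a < 2 ^ i" by (meson not_less less_le_trans one_le_numeral power_increasing)
  then show False using \<open>i \<in> set_decode a\<close> by (simp add: set_decode_def)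
qed

lemma set_encode_bound: "S \<subseteq> {..<n} \<Longrightarrow> set_encode S < 2 ^ n"
proof (induction n arbitrary: S)
  case (Suc n)
  have fin: "finite S" using Suc.prems finite_subset by blast
  have "set_encode S \<le> set_encode (insert n (S - {n}))"
    using fin by (cases "n \<in> S") (auto simp: insert_absorb)
  also have "\<dots> = 2 ^ n + set_encode (S - {n})" using fin set_encode_insert[of "S - {n}" n] by simp
  also have "\<dots> < 2 ^ n + 2 ^ n" using Suc.IH[of "S - {n}"] Suc.prems by fastforce
  finally show ?case by simp
qed auto

text \<open>Limits are reached through this rule: finitely many events that persist once they occur
  are all decided correctly from some common stage on.\<close>

lemma eventually_mono_ex:
  fixes P :: "nat \<Rightarrow> bool"
  assumes "\<And>s s'. s \<le> s' \<Longrightarrow> P s \<Longrightarrow> P s'"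
  shows "\<forall>\<^sub>F s in sequentially. P s \<longleftrightarrow> (\<exists>s. P s)"
proof (cases "\<exists>s. P s")
  case True
  then obtain s where "P s" by blast
  then show ?thesis using assms unfolding eventually_sequentially by blast
qed auto

lemma eventually_W_at: "\<forall>\<^sub>F s in sequentially. x \<in> W_at e s \<longleftrightarrow> x \<in> W e"
proof -
  have "s \<le> s' \<Longrightarrow> x \<in> W_at e s \<Longrightarrow> x \<in> W_at e s'" for s s' using W_at_mono by blast
  from eventually_mono_ex[OF this] show ?thesis by (simp add: W_eq_UN_W_at)
qed

lemma W_at_subset: "W_at e s \<subseteq> W e"
  unfolding W_eq_UN_W_at by blast

lemma ce_decidable: "decidable P \<Longrightarrow> ce {x. P x}"
  using ceI[of "\<lambda>x u. P x"] dec_comp[of P p1] by (simp add: comp)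

lemma ce_Int: "ce A \<Longrightarrow> ce B \<Longrightarrow> ce (A \<inter> B)"
proof -
  assume "ce A" "ce B"
  then obtain a b where ab: "A = W a" "B = W b" by (auto simp: ce_def)
  have "A \<inter> B = {x. \<exists>u. x \<in> W_at a u \<and> x \<in> W_at b u}"
  proof (intro equalityI subsetI)
    fix x assume "x \<in> A \<inter> B"
    then obtain s s' where "x \<in> W_at a s" "x \<in> W_at b s'" unfolding ab W_eq_UN_W_at by blast
    then have "x \<in> W_at a (max s s')" "x \<in> W_at b (max s s')"
      using W_at_mono[of s "max s s'"] W_at_mono[of s' "max s s'"] by auto
    then show "x \<in> {x. \<exists>u. x \<in> W_at a u \<and> x \<in> W_at b u}" by blast
  qed (auto simp: ab W_eq_UN_W_at)
  also have "ce \<dots>" by (rule ceI) (intro comp)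
  finally show ?thesis .
qed

lemma ce_Un: "ce A \<Longrightarrow> ce B \<Longrightarrow> ce (A \<union> B)"
proof -
  assume "ce A" "ce B"
  then obtain a b where ab: "A = W a" "B = W b" by (auto simp: ce_def)
  have "A \<union> B = {x. \<exists>u. x \<in> W_at a u \<or> x \<in> W_at b u}"
    unfolding ab W_eq_UN_W_at by blast
  also have "ce \<dots>" by (rule ceI) (intro comp)
  finally show ?thesis .
qed

lemma decidable_finite: "finite F \<Longrightarrow> decidable (\<lambda>x. x \<in> F)"
proof (induction rule: finite_induct)
  case (insert a F)
  have "decidable (\<lambda>x. x = a \<or> x \<in> F)" by (intro comp insert.IH)
  then show ?case by simp
qed (simp add: comp)

lemma ce_finite: "finite F \<Longrightarrow> ce F"
  using ce_decidable[OF decidable_finite] by simp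

lemma ce_Diff_finite: "ce A \<Longrightarrow> finite F \<Longrightarrow> ce (A - F)"
  using ce_Int[OF _ ce_decidable[OF dec_not[OF decidable_finite]]] by (simp add: Diff_eq Compl_eq)

lemma ce_UNIV: "ce UNIV"
  using ce_decidable[of "\<lambda>_. True"] by (simp add: comp)

lemma ce_ball_less:
  fixes S :: "nat \<Rightarrow> nat set"
  shows "(\<And>i. i < n \<Longrightarrow> ce (S i)) \<Longrightarrow> ce {x. \<forall>i<n. x \<in> S i}"
proof (induction n)
  case (Suc n)
  have "{x. \<forall>i<Suc n. x \<in> S i} = {x. \<forall>i<n. x \<in> S i} \<inter> S n" by (auto simp: less_Suc_eq)
  then show ?case using ce_Int Suc by simp
qed (simp add: ce_UNIV)

section \<open>Finite tables and the s-m-n theorem\<close>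

lemma comp_finite_table: "computable (\<lambda>l. if l < n then g l else 0)"
proof (induction n)
  case (Suc n)
  have "computable (\<lambda>l. if l = n then g n else if l < n then g l else 0)"
    by (intro comp Suc.IH[unfolded if_distrib])
  moreover have "(\<lambda>l. if l = n then g n else if l < n then g l else 0) =
      (\<lambda>l. if l < Suc n then g l else 0)" by auto
  ultimately show ?case by simp
qed (simp add: comp)

primrec const_prog :: "nat \<Rightarrow> prog" where
  "const_prog 0 = Zero"
| "const_prog (Suc n) = Comp Succ (const_prog n)"

lemma runs_const_prog: "\<exists>t. runs (const_prog n) x n t"
proof (induction n)
  case 0 show ?case using runs_Zero by auto
next
  case (Suc n) then show ?case using runs_Comp runs_Succ by fastforce
qed

text \<open>A program for the constant \<open>y\<close> is put in front of the given one; its code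
  is a primitive recursive function of \<open>y\<close>.\<close>

lemma smn: "\<exists>c. computable c \<and> (\<forall>y. W (c y) = {x. prod_encode (y, x) \<in> W e})"
proof -
  obtain p where p: "code p = e" using surj_code by blast
  let ?q = "\<lambda>y. Comp p (Pair (const_prog y) (Pair Fst Snd))"
  have "code (const_prog y) = rec_nat 0 (\<lambda>_ r. 4 * prod_encode (1, r) + 5) y" for y
    by (induction y) simp_all
  moreover have "computable (\<lambda>y. 4 * prod_encode (code p, 4 * prod_encode
      (rec_nat 0 (\<lambda>_ r. 4 * prod_encode (1, r) + 5) y, code (Pair Fst Snd)) + 4) + 5)"
    by (intro comp)
  ultimately have "computable (\<lambda>y. code (?q y))" by (simp only: code.simps)
  moreover have "W (code (?q y)) = {x. prod_encode (y, x) \<in> W e}" for y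
  proof -
    have pair: "\<exists>t. runs (Pair (const_prog y) (Pair Fst Snd)) x (prod_encode (y, x)) t" for x
      using runs_Pair runs_const_prog runs_pair_id by blast
    have "(\<exists>z t. runs (?q y) x z t) \<longleftrightarrow> (\<exists>z t. runs p (prod_encode (y, x)) z t)" for x
    proof
      assume "\<exists>z t. runs (?q y) x z t"
      then obtain z t where "runs (?q y) x z t" by blast
      then show "\<exists>z t. runs p (prod_encode (y, x)) z t"
        using pair[of x] runs_fun by cases metis
    next
      assume "\<exists>z t. runs p (prod_encode (y, x)) z t"
      then show "\<exists>z t. runs (?q y) x z t" using pair[of x] runs_Comp by blast
    qed
    then show ?thesis unfolding p[symmetric] W_code by auto
  qed
  ultimately show ?thesis by blast
qed

section \<open>Alternating unions and the count of their changes\<close>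

lemma alt_union_pairs:
  "alt_union (concat (map (\<lambda>l. [f l, g l]) ls) @ R) = (\<Union>l\<in>set ls. f l - g l) \<union> alt_union R"
  by (induction ls) auto

lemma length_pairs: "length (concat (map (\<lambda>l. [f l, g l]) ls)) = 2 * length ls"
  by (induction ls) auto

definition hits :: "nat list \<Rightarrow> nat \<Rightarrow> nat \<Rightarrow> nat" where
  "hits es s x = length (filter (\<lambda>i. x \<in> W_at i s) es)"

lemma hits_le: "hits es s x \<le> length es"
  by (simp add: hits_def)

lemma hits_mono: "s \<le> s' \<Longrightarrow> hits es s x \<le> hits es s' x"
  unfolding hits_def by (induction es) (use W_at_mono in auto)

text \<open>The components only grow, so membership in the alternating union can change only if some
  component has received \<open>x\<close>. Hence \<open>n\<close> components allow at most
  \<open>n\<close> changes.\<close>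

lemma hits_change:
  assumes "s \<le> s'"
  shows "(x \<in> alt_union (map (\<lambda>i. W_at i s) es)) \<noteq> (x \<in> alt_union (map (\<lambda>i. W_at i s') es)) \<Longrightarrow>
    hits es s x < hits es s' x"
proof (induction es rule: induct_list012)
  case 1 then show ?case by simp
next
  case (2 i)
  then show ?case using W_at_mono[OF assms, of i] by (auto simp: hits_def)
next
  case (3 i j es)
  have m: "hits es s x \<le> hits es s' x" by (rule hits_mono[OF assms])
  have sub: "x \<in> W_at i s \<Longrightarrow> x \<in> W_at i s'" "x \<in> W_at j s \<Longrightarrow> x \<in> W_at j s'"
    using W_at_mono[OF assms] by blast+
  show ?case
  proof (cases "(x \<in> alt_union (map (\<lambda>i. W_at i s) es)) = (x \<in> alt_union (map (\<lambda>i. W_at i s') es))")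
    case True
    then have "(x \<in> W_at i s) \<noteq> (x \<in> W_at i s') \<or> (x \<in> W_at j s) \<noteq> (x \<in> W_at j s')"
      using "3.prems" by auto
    then show ?thesis using sub m by (auto simp: hits_def)
  next
    case False
    then have "hits es s x < hits es s' x" using "3.IH"(1) by blast
    then show ?thesis using sub by (auto simp: hits_def)
  qed
qed

lemma X_nce_at_0: "x \<notin> X_nce_at n e 0"
proof -
  have "x \<notin> alt_union (map (\<lambda>i. W_at i 0) es)" for es
    by (induction es rule: induct_list012) (auto simp: W_at_def)
  then show ?thesis by (simp add: X_nce_at_def)
qed

lemma eventually_X_nce_at: "\<forall>\<^sub>F s in sequentially. x \<in> X_nce_at n e s \<longleftrightarrow> x \<in> X_nce n e"
proof -
  have "\<forall>\<^sub>F s in sequentially. x \<in> alt_union (map (\<lambda>i. W_at i s) es) \<longleftrightarrow> x \<in> alt_union (map W es)" for es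
  proof (induction es rule: induct_list012)
    case (2 i)
    then show ?case using eventually_W_at by simp
  next
    case (3 i j es)
    from "3.IH"(1) eventually_W_at[of x i] eventually_W_at[of x j] show ?case
      by eventually_elim auto
  qed simp
  then show ?thesis by (simp add: X_nce_at_def X_nce_def)
qed

section \<open>The construction\<close>

abbreviation level :: "nat \<Rightarrow> nat" where "level x \<equiv> p1 x"
abbreviation guess :: "nat \<Rightarrow> nat" where "guess x \<equiv> p1 (p2 x)"

text \<open>A requirement \<open>e\<close> codes the c.e. set \<open>W (w_of e)\<close> that may contain the complement of \<open>C\<close>, the
  chain with index \<open>i_of e\<close> and the pair \<open>W (a_of e)\<close>, \<open>W (b_of e)\<close> that may split \<open>C\<close>. Each number
  \<open>x\<close> is labelled with a guess at the set of those \<open>e < level x\<close> whose hypotheses are true.\<close>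

abbreviation w_of :: "nat \<Rightarrow> nat" where "w_of e \<equiv> p1 e"
abbreviation i_of :: "nat \<Rightarrow> nat" where "i_of e \<equiv> p1 (p2 e)"
abbreviation a_of :: "nat \<Rightarrow> nat" where "a_of e \<equiv> p1 (p2 (p2 e))"
abbreviation b_of :: "nat \<Rightarrow> nat" where "b_of e \<equiv> p2 (p2 (p2 e))"

text \<open>A chain is given by a program that receives its own index as part of the input; this makes
  the recursion theorem unnecessary.\<close>

definition BB :: "nat \<Rightarrow> nat \<Rightarrow> nat set" where
  "BB i l = {x. prod_encode (i, prod_encode (l, x)) \<in> W i}"

definition BB_at :: "nat \<Rightarrow> nat \<Rightarrow> nat \<Rightarrow> nat set" where
  "BB_at i l s = {x. prod_encode (i, prod_encode (l, x)) \<in> W_at i s}"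

locale construction =
  fixes m k :: nat
  assumes m2: "2 \<le> m" and k: "k = m div 2"
begin

text \<open>The state of \<open>x\<close> at a stage is one number: its status paired with the
  canonical index of the set of requirements that have come true on it. The history \<open>f\<close>
  is a parameter because \<open>inD\<close> looks back at earlier stages.\<close>

definition val :: "(nat \<Rightarrow> nat \<Rightarrow> nat) \<Rightarrow> nat \<Rightarrow> nat \<Rightarrow> nat" where
  "val f s x = p1 (f s x)"

definition met :: "(nat \<Rightarrow> nat \<Rightarrow> nat) \<Rightarrow> nat \<Rightarrow> nat \<Rightarrow> nat \<Rightarrow> bool" where
  "met f s e x \<longleftrightarrow> e \<in> set_decode (p2 (f s x))"

text \<open>A requirement outside the guess that has come true silences all of larger index; those
  still asked form an initial part of the guess.\<close>

definition asked :: "(nat \<Rightarrow> nat \<Rightarrow> nat) \<Rightarrow> nat \<Rightarrow> nat \<Rightarrow> nat \<Rightarrow> bool" where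
  "asked f s x r \<longleftrightarrow> r < level x \<and> r \<in> set_decode (guess x) \<and>
     (\<forall>e<r. e \<notin> set_decode (guess x) \<longrightarrow> \<not> met f s e x)"

definition refuted :: "(nat \<Rightarrow> nat \<Rightarrow> nat) \<Rightarrow> nat \<Rightarrow> nat \<Rightarrow> bool" where
  "refuted f s x \<longleftrightarrow> (\<exists>e<level x. e \<notin> set_decode (guess x) \<and> met f s e x)"

text \<open>In round \<open>l\<close> a requirement stops holding \<open>x\<close> back if
  \<open>x\<close> is in the other half of its splitting, if one of smaller index with the same
  chain is responsible for \<open>x\<close>, or if the chain has answered.\<close>

definition cleared :: "(nat \<Rightarrow> nat \<Rightarrow> nat) \<Rightarrow> nat \<Rightarrow> nat \<Rightarrow> nat \<Rightarrow> nat \<Rightarrow> bool" where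
  "cleared f l s x r \<longleftrightarrow> x \<in> W_at (b_of r) s \<or>
     (\<exists>r'<r. asked f s x r' \<and> i_of r' = i_of r \<and> x \<in> W_at (a_of r') s) \<or>
     x \<in> BB_at (i_of r) l s"

text \<open>Since one chain serves many requirements, a question on behalf of \<open>r\<close> waits
  until the smaller ones with that chain disclaim \<open>x\<close>: so a true requirement with
  \<open>x\<close> in its half \<open>a_of\<close> is never bypassed by a larger one.\<close>

definition asks :: "(nat \<Rightarrow> nat \<Rightarrow> nat) \<Rightarrow> nat \<Rightarrow> nat \<Rightarrow> nat \<Rightarrow> nat \<Rightarrow> bool" where
  "asks f i l s x \<longleftrightarrow> (\<exists>r<level x. asked f s x r \<and> i_of r = i \<and> x \<in> W_at (a_of r) s \<and>
     (\<forall>r'<r. asked f s x r' \<and> i_of r' = i \<longrightarrow> x \<in> W_at (b_of r') s) \<and>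
     (\<forall>r'<level x. r < r' \<and> asked f s x r' \<longrightarrow> cleared f l s x r'))"

text \<open>A question of a later round counts for all rounds before it; this makes the sets descend
  in \<open>l\<close>.\<close>

definition inD :: "(nat \<Rightarrow> nat \<Rightarrow> nat) \<Rightarrow> nat \<Rightarrow> nat \<Rightarrow> nat \<Rightarrow> nat \<Rightarrow> bool" where
  "inD f s i l x \<longleftrightarrow> (\<exists>s'<s. even (val f s' x) \<and> 2 * l \<le> val f s' x \<and> val f s' x \<le> 2 * k \<and>
     asks f i (val f s' x div 2) s' x)"

text \<open>A length of agreement: at stage \<open>s\<close> the hypotheses of \<open>e\<close> look
  true of all numbers below \<open>t\<close>.\<close>

definition good :: "(nat \<Rightarrow> nat \<Rightarrow> nat) \<Rightarrow> nat \<Rightarrow> nat \<Rightarrow> nat \<Rightarrow> bool" where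
  "good f e s t \<longleftrightarrow> t \<le> s \<and> (\<forall>x<t.
     (val f s x = 0 \<longrightarrow> x \<in> W_at (w_of e) s) \<and>
     (val f s x \<noteq> 0 \<longrightarrow> x \<in> W_at (a_of e) s \<or> x \<in> W_at (b_of e) s) \<and>
     \<not> (x \<in> W_at (a_of e) s \<and> x \<in> W_at (b_of e) s) \<and>
     (val f s x \<noteq> 0 \<and> val f s x \<le> 2 * k \<and> x \<in> W_at (a_of e) s \<longrightarrow>
       (\<forall>l\<le>k. 1 \<le> l \<longrightarrow> (x \<in> BB_at (i_of e) l s \<longleftrightarrow> inD f s (i_of e) l x))))"

definition trigger :: "nat \<Rightarrow> nat \<Rightarrow> bool" where
  "trigger s x \<longleftrightarrow> even (level x) \<and> x \<in> X_nce_at (m - 1) (level x div 2) s"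

text \<open>The last clause, by which all rivals must have been refuted, leaves only finitely many
  numbers with the correct guess at each level.\<close>

definition enters :: "(nat \<Rightarrow> nat \<Rightarrow> nat) \<Rightarrow> nat \<Rightarrow> nat \<Rightarrow> bool" where
  "enters f s x \<longleftrightarrow> x < s \<and> guess x < 2 ^ level x \<and>
     (\<forall>e<level x. e \<in> set_decode (guess x) \<longleftrightarrow> met f s e x) \<and>
     (\<forall>y<s. val f s y \<noteq> 0 \<and> level y = level x \<and> guess y = guess x \<longrightarrow> refuted f s y)"

text \<open>The status of \<open>x\<close>: \<open>0\<close> while \<open>x\<close> is outside \<open>C\<close>; then \<open>2 * l - 1\<close> while \<open>x\<close> waits to begin its
  \<open>l\<close>-th round of questions and \<open>2 * l\<close> during that round; finally \<open>2 * k + 1\<close> when \<open>x\<close> is put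
  into \<open>Y\<close> and \<open>2 * k + 2\<close> when \<open>x\<close> is put into \<open>A\<close>.\<close>

definition new_val :: "(nat \<Rightarrow> nat \<Rightarrow> nat) \<Rightarrow> nat \<Rightarrow> nat \<Rightarrow> nat" where
  "new_val f s x =
    (if 2 * k < val f s x then val f s x
     else if val f s x = 0 then of_bool (enters f s x)
     else if odd (val f s x) then
       (if refuted f s x \<or> trigger s x then val f s x + 1 else val f s x)
     else if \<forall>r<level x. asked f s x r \<longrightarrow> cleared f (val f s x div 2) s x r then
       (if refuted f s x \<or> trigger s x then 2 * k + 2
        else if val f s x < 2 * k \<or> odd m then val f s x + 1 else 2 * k + 2)
     else val f s x)"

definition next_state :: "(nat \<Rightarrow> nat \<Rightarrow> nat) \<Rightarrow> nat \<Rightarrow> nat \<Rightarrow> nat" where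
  "next_state f s x =
    prod_encode (new_val f s x, \<Sum>e<level x. of_bool (met f s e x \<or> good f e s (x + 1)) * 2 ^ e)"

text \<open>Course-of-values recursion: a new row depends on all previous ones, so the whole table
  is carried along.\<close>

primrec table :: "nat \<Rightarrow> nat \<Rightarrow> nat \<Rightarrow> nat" where
  "table 0 = (\<lambda>_ _. 0)"
| "table (Suc s) = (table s)(Suc s := next_state (table s) s)"

definition state :: "nat \<Rightarrow> nat \<Rightarrow> nat" where
  "state s = table s s"

section \<open>Dependence of a stage on the rows up to it\<close>

context
  fixes f g :: "nat \<Rightarrow> nat \<Rightarrow> nat" and s :: nat
  assumes fg: "\<And>s'. s' \<le> s \<Longrightarrow> f s' = g s'"
begin

lemma val_cong: "s' \<le> s \<Longrightarrow> val f s' = val g s'"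
  using fg by (simp add: val_def fun_eq_iff)

lemma met_cong: "s' \<le> s \<Longrightarrow> met f s' = met g s'"
  using fg by (simp add: met_def fun_eq_iff)

lemma asked_cong: "s' \<le> s \<Longrightarrow> asked f s' = asked g s'"
  using met_cong by (simp add: asked_def fun_eq_iff)

lemma refuted_cong: "s' \<le> s \<Longrightarrow> refuted f s' = refuted g s'"
  using met_cong by (simp add: refuted_def fun_eq_iff)

lemma cleared_cong: "s' \<le> s \<Longrightarrow> cleared f l s' = cleared g l s'"
  using asked_cong by (simp add: cleared_def fun_eq_iff)

lemma asks_cong: "s' \<le> s \<Longrightarrow> asks f i l s' = asks g i l s'"
  using asked_cong cleared_cong by (simp add: asks_def fun_eq_iff)

lemma inD_cong: "inD f s = inD g s"
  using val_cong asks_cong by (auto simp: inD_def fun_eq_iff)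

lemma good_cong: "good f e s = good g e s"
  using val_cong[OF order_refl] inD_cong by (simp add: good_def fun_eq_iff)

lemma enters_cong: "enters f s = enters g s"
  using val_cong[OF order_refl] met_cong[OF order_refl] refuted_cong[OF order_refl]
  by (simp add: enters_def fun_eq_iff)

lemma next_state_cong: "next_state f s = next_state g s"
  unfolding next_state_def new_val_def val_cong[OF order_refl] met_cong[OF order_refl]
    asked_cong[OF order_refl] refuted_cong[OF order_refl] cleared_cong[OF order_refl]
    good_cong enters_cong ..

end

lemma table_state: "s' \<le> s \<Longrightarrow> table s s' = state s'"
  by (induction s) (auto simp: state_def le_Suc_eq)

lemma state_Suc: "state (Suc s) = next_state state s"
proof -
  have "state (Suc s) = next_state (table s) s" by (simp add: state_def)
  also have "\<dots> = next_state state s" by (rule next_state_cong) (simp add: table_state)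
  finally show ?thesis .
qed

lemma state_0: "state 0 = (\<lambda>_. 0)"
  by (simp add: state_def)

lemma prod_encode_0: "prod_encode (0, 0) = 0"
  by (simp add: prod_encode_def)

lemma prod_decode_0 [simp]: "prod_decode 0 = (0, 0)"
  by (metis prod_encode_0 prod_encode_inverse)

lemma state_bound: "s \<le> x \<Longrightarrow> state s x = 0"
proof (induction s)
  case 0 then show ?case by (simp add: state_0)
next
  case (Suc s)
  then have "state s x = 0" "x \<ge> s" by auto
  then show ?case
    by (simp add: state_Suc next_state_def new_val_def val_def met_def enters_def good_def prod_encode_0)
qed

subsection \<open>Computability of the construction\<close>

text \<open>The history is coded with the latest row outermost and, in each row, the largest number
  outermost; hence the two differences. Row \<open>s'\<close> stores only entries below
  \<open>s'\<close>; the others are 0 by \<open>state_bound\<close>.\<close>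

definition look :: "nat \<Rightarrow> nat \<Rightarrow> nat \<Rightarrow> nat \<Rightarrow> nat" where
  "look c s s' x = (if s' \<le> s \<and> x < s' then p1 ((p2 ^^ (s' - 1 - x)) (p1 ((p2 ^^ (s - s')) c))) else 0)"

definition hist_step :: "nat \<Rightarrow> nat \<Rightarrow> nat" where
  "hist_step s c = prod_encode (rec_nat 0 (\<lambda>x r. prod_encode (next_state (look c s) s x, r)) (Suc s), c)"

definition hist :: "nat \<Rightarrow> nat" where
  "hist = rec_nat 0 hist_step"

lemma look_row:
  "x < n \<Longrightarrow> p1 ((p2 ^^ (n - 1 - x)) (rec_nat 0 (\<lambda>x r. prod_encode (g x, r)) n)) = g x"
proof (induction n)
  case (Suc n)
  show ?case
  proof (cases "x = n")
    case False
    then have n: "Suc n - 1 - x = Suc (n - 1 - x)" and "x < n" using Suc.prems by simp_all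
    then show ?thesis using Suc.IH unfolding n funpow_1 by simp
  qed simp
qed simp

lemma look_hist: "look (hist s) s = table s"
proof (induction s)
  case 0
  show ?case by (auto simp: look_def fun_eq_iff)
next
  case (Suc s)
  have h: "hist (Suc s) = hist_step s (hist s)" by (simp add: hist_def)
  have "look (hist (Suc s)) (Suc s) s' x = table (Suc s) s' x" for s' x
  proof (cases "s' = Suc s")
    case True
    show ?thesis
    proof (cases "x < Suc s")
      case True2: True
      have "look (hist (Suc s)) (Suc s) s' x = p1 ((p2 ^^ (Suc s - 1 - x)) (p1 (hist (Suc s))))"
        using True True2 by (subst look_def) simp
      also have "p1 (hist (Suc s)) =
          rec_nat 0 (\<lambda>x r. prod_encode (next_state (table s) s x, r)) (Suc s)"
        unfolding h hist_step_def Suc by simp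
      also have "p1 ((p2 ^^ (Suc s - 1 - x)) \<dots>) = next_state (table s) s x"
        by (rule look_row[OF True2])
      finally show ?thesis using True by simp
    next
      case False
      then have "table (Suc s) s' x = state (Suc s) x" "state (Suc s) x = 0"
        using True by (simp_all add: table_state state_bound del: table.simps)
      then show ?thesis using False True by (simp add: look_def del: table.simps)
    qed
  next
    case False
    have "look (hist (Suc s)) (Suc s) s' x = look (hist s) s s' x"
    proof (cases "s' \<le> s")
      case True
      then have "(p2 ^^ (Suc s - s')) (hist (Suc s)) = (p2 ^^ (s - s')) (hist s)"
        by (simp only: Suc_diff_le funpow_1 h) (simp add: hist_step_def)
      then show ?thesis using True by (simp add: look_def del: funpow.simps)
    qed (use False in \<open>auto simp: look_def\<close>)
    then show ?thesis using False Suc by simp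
  qed
  then show ?case by (simp add: fun_eq_iff del: table.simps)
qed

lemma comp_look:
  assumes "computable c" "computable t" "computable s" "computable x"
  shows "computable (\<lambda>z. look (c z) (t z) (s z) (x z))"
  unfolding look_def by (intro comp assms)

lemma comp_val:
  assumes "computable c" "computable t" "computable s" "computable x"
  shows "computable (\<lambda>z. val (look (c z) (t z)) (s z) (x z))"
  unfolding val_def by (intro comp comp_look assms)

lemma dec_met:
  assumes "computable c" "computable t" "computable s" "computable x" "computable e"
  shows "decidable (\<lambda>z. met (look (c z) (t z)) (s z) (e z) (x z))"
  unfolding met_def by (intro comp comp_look assms)

lemma dec_BB_at [comp]:
  assumes "computable i" "computable l" "computable s" "computable x"
  shows "decidable (\<lambda>z. x z \<in> BB_at (i z) (l z) (s z))"
  unfolding BB_at_def mem_Collect_eq by (intro comp assms)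

lemma dec_asked:
  assumes "computable c" "computable t" "computable s" "computable x" "computable r"
  shows "decidable (\<lambda>z. asked (look (c z) (t z)) (s z) (x z) (r z))"
  unfolding asked_def
  by (intro comp dec_met assms assms[THEN comp_comp])

lemma dec_refuted:
  assumes "computable c" "computable t" "computable s" "computable x"
  shows "decidable (\<lambda>z. refuted (look (c z) (t z)) (s z) (x z))"
  unfolding refuted_def
  by (intro comp dec_met assms assms[THEN comp_comp])

lemma dec_cleared:
  assumes "computable c" "computable t" "computable s" "computable x" "computable r" "computable l"
  shows "decidable (\<lambda>z. cleared (look (c z) (t z)) (l z) (s z) (x z) (r z))"
  unfolding cleared_def
  by (intro comp dec_asked assms assms[THEN comp_comp])

lemma dec_asks:
  assumes "computable c" "computable t" "computable s" "computable x" "computable i" "computable l"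
  shows "decidable (\<lambda>z. asks (look (c z) (t z)) (i z) (l z) (s z) (x z))"
  unfolding asks_def
  by (intro comp dec_asked dec_cleared assms assms[THEN comp_comp])

lemma dec_inD:
  assumes "computable c" "computable t" "computable s" "computable x" "computable i" "computable l"
  shows "decidable (\<lambda>z. inD (look (c z) (t z)) (s z) (i z) (l z) (x z))"
  unfolding inD_def
  by (intro comp dec_asks comp_val assms assms[THEN comp_comp])

lemma dec_good:
  assumes "computable c" "computable t" "computable s" "computable e" "computable b"
  shows "decidable (\<lambda>z. good (look (c z) (t z)) (e z) (s z) (b z))"
  unfolding good_def
  by (intro comp dec_inD comp_val assms assms[THEN comp_comp])

lemma dec_trigger:
  assumes "computable s" "computable x"
  shows "decidable (\<lambda>z. trigger (s z) (x z))"
  unfolding trigger_def by (intro comp assms)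

lemma dec_enters:
  assumes "computable c" "computable t" "computable s" "computable x"
  shows "decidable (\<lambda>z. enters (look (c z) (t z)) (s z) (x z))"
  unfolding enters_def
  by (intro comp dec_met dec_refuted comp_val assms assms[THEN comp_comp])

lemma comp_next_state:
  assumes "computable c" "computable t" "computable s" "computable x"
  shows "computable (\<lambda>z. next_state (look (c z) (t z)) (s z) (x z))"
  unfolding next_state_def new_val_def
  by (intro comp dec_met dec_good dec_refuted dec_trigger dec_enters dec_asked dec_cleared comp_val
    assms assms[THEN comp_comp])

lemma comp_hist: "computable hist"
proof -
  have "computable (\<lambda>s. rec_nat 0 hist_step s)"
    unfolding hist_step_def by (intro comp comp_next_state)
  then show ?thesis by (simp add: hist_def)
qed

lemma comp_state [comp]:
  assumes "computable s" "computable x" shows "computable (\<lambda>z. state (s z) (x z))"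
proof -
  have "computable (\<lambda>z. look (hist (s z)) (s z) (s z) (x z))"
    by (intro comp_look comp_comp[OF comp_hist] assms)
  then show ?thesis by (simp add: look_hist state_def)
qed

lemma good_table: "good state e s = good (look (hist s) s) e s"
  by (rule good_cong) (simp add: look_hist table_state)

lemma inD_table: "inD state s = inD (look (hist s) s) s"
  by (rule inD_cong) (simp add: look_hist table_state)

lemma dec_good_state [comp]:
  assumes "computable e" "computable s" "computable t"
  shows "decidable (\<lambda>z. good state (e z) (s z) (t z))"
  unfolding good_table by (intro dec_good comp_comp[OF comp_hist] assms)

lemma dec_inD_state [comp]:
  assumes "computable s" "computable i" "computable l" "computable x"
  shows "decidable (\<lambda>z. inD state (s z) (i z) (l z) (x z))"
  unfolding inD_table by (intro dec_inD comp_comp[OF comp_hist] assms)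

lemma comp_val_state [comp]:
  assumes "computable s" "computable x" shows "computable (\<lambda>z. val state (s z) (x z))"
  unfolding val_def by (intro comp assms)

end

section \<open>Verification\<close>

lemma eventually_BB_at: "\<forall>\<^sub>F s in sequentially. x \<in> BB_at i l s \<longleftrightarrow> x \<in> BB i l"
  unfolding BB_at_def BB_def mem_Collect_eq by (rule eventually_W_at)

lemma BB_at_mono: "s \<le> s' \<Longrightarrow> BB_at i l s \<subseteq> BB_at i l s'"
  unfolding BB_at_def using W_at_mono by blast

lemma BB_at_subset: "BB_at i l s \<subseteq> BB i l"
  unfolding BB_at_def BB_def W_eq_UN_W_at by blast

context construction
begin

abbreviation v :: "nat \<Rightarrow> nat \<Rightarrow> nat" where "v \<equiv> val state"

definition C :: "nat set" where "C = {x. \<exists>s. v s x \<noteq> 0}"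
definition H :: "nat set" where "H = {x. \<exists>s. 2 * k < v s x}"
definition D :: "nat \<Rightarrow> nat \<Rightarrow> nat set" where "D i l = {x. \<exists>s. inD state s i l x}"

abbreviation G :: "nat \<Rightarrow> nat set" where "G x \<equiv> set_decode (guess x)"

text \<open>The analogue of the true path.\<close>

definition TP :: "nat set" where "TP = {e. \<forall>t. \<exists>s. good state e s t}"

section \<open>Monotonicity of the status and of the requirements met\<close>

lemma k1: "1 \<le> k" using m2 k by simp

lemma v_0: "v 0 x = 0" by (simp add: val_def state_0)

lemma v_Suc: "v (Suc s) x = new_val state s x"
  by (simp add: val_def[of state "Suc s"] state_Suc next_state_def)

lemma met_0: "\<not> met state 0 e x" by (simp add: met_def state_0)

lemma met_Suc: "met state (Suc s) e x \<longleftrightarrow> e < level x \<and> (met state s e x \<or> good state e s (x + 1))"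
  by (subst met_def) (simp only: state_Suc next_state_def prod_encode_inverse snd_conv set_decode_sum)

lemma met_iff: "met state s e x \<longleftrightarrow> e < level x \<and> (\<exists>s'<s. good state e s' (x + 1))"
  by (induction s) (auto simp: met_0 met_Suc less_Suc_eq)

lemma met_mono: "s \<le> s' \<Longrightarrow> met state s e x \<Longrightarrow> met state s' e x"
  unfolding met_iff using less_le_trans by blast

lemma asked_antimono: "s \<le> s' \<Longrightarrow> asked state s' x r \<Longrightarrow> asked state s x r"
  unfolding asked_def using met_mono by blast

lemma asked_less: "asked state s x r \<Longrightarrow> asked state s' x r' \<Longrightarrow> r' < r \<Longrightarrow> asked state s x r'"
  unfolding asked_def by auto

lemma refuted_mono: "s \<le> s' \<Longrightarrow> refuted state s x \<Longrightarrow> refuted state s' x"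
  unfolding refuted_def using met_mono by blast

text \<open>A clearance by means of a smaller \<open>r'\<close> lasts as long as \<open>r\<close> is
  asked, for then \<open>r'\<close> is asked as well.\<close>

lemma cleared_mono:
  "s \<le> s' \<Longrightarrow> cleared state l s x r \<Longrightarrow> asked state s' x r \<Longrightarrow> cleared state l s' x r"
  unfolding cleared_def using W_at_mono[of s s'] BB_at_mono[of s s'] asked_less[of s' x r s] by blast

lemma inD_mono: "s \<le> s' \<Longrightarrow> inD state s i l x \<Longrightarrow> inD state s' i l x"
  unfolding inD_def using less_le_trans by blast

lemma good_antimono: "t' \<le> t \<Longrightarrow> good state e s t \<Longrightarrow> good state e s t'"
  unfolding good_def by auto

lemma goodD:
  assumes "good state e s (x + 1)"
  shows "(val state s x = 0 \<longrightarrow> x \<in> W_at (w_of e) s) \<and>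
     (val state s x \<noteq> 0 \<longrightarrow> x \<in> W_at (a_of e) s \<or> x \<in> W_at (b_of e) s) \<and>
     \<not> (x \<in> W_at (a_of e) s \<and> x \<in> W_at (b_of e) s) \<and>
     (val state s x \<noteq> 0 \<and> val state s x \<le> 2 * k \<and> x \<in> W_at (a_of e) s \<longrightarrow>
       (\<forall>l\<le>k. 1 \<le> l \<longrightarrow> (x \<in> BB_at (i_of e) l s \<longleftrightarrow> inD state s (i_of e) l x)))"
  using assms unfolding good_def by (elim conjE allE[of _ x]) simp

lemma v_le: "v s x \<le> 2 * k + 2"
  by (induction s) (auto simp: v_0 v_Suc new_val_def)

lemma v_step: "v (Suc s) x = v s x \<or> v (Suc s) x = v s x + 1 \<or>
    (even (v s x) \<and> 2 \<le> v s x \<and> v s x \<le> 2 * k \<and> v (Suc s) x = 2 * k + 2)"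
proof -
  have "even (v s x) \<Longrightarrow> 0 < v s x \<Longrightarrow> 2 \<le> v s x" by (cases "v s x = 1") auto
  then show ?thesis unfolding v_Suc new_val_def by auto
qed

lemma v_mono: "s \<le> s' \<Longrightarrow> v s x \<le> v s' x"
proof (induction s' rule: dec_induct)
  case (step n)
  then show ?case using v_step[of n x] by auto
qed auto

lemma v_final: "s \<le> s' \<Longrightarrow> 2 * k < v s x \<Longrightarrow> v s' x = v s x"
proof (induction s' rule: dec_induct)
  case (step n)
  then show ?case by (simp add: v_Suc new_val_def)
qed auto

lemma v_bound: "s \<le> x \<Longrightarrow> v s x = 0"
  by (simp add: val_def state_bound)

lemma v_stable: "\<exists>s1\<ge>s0. \<forall>s\<ge>s1. v s x = v s1 x"
proof -
  have fin: "finite ((\<lambda>s. v s x) ` {s0..})"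
    by (rule finite_subset[of _ "{..2 * k + 2}"]) (use v_le in auto)
  obtain s1 where s1: "s1 \<ge> s0" "v s1 x = Max ((\<lambda>s. v s x) ` {s0..})"
    using Max_in[OF fin] by fastforce
  have "v s x = v s1 x" if "s \<ge> s1" for s
    using Max_ge[OF fin, of "v s x"] s1 that v_mono[OF that, of x] by fastforce
  then show ?thesis using s1(1) by blast
qed

lemma entry:
  assumes "x \<in> C"
  obtains s where "v s x = 0" "v (Suc s) x = 1" "enters state s x"
proof -
  let ?s = "LEAST s. v s x \<noteq> 0"
  obtain s0 where s0: "v s0 x \<noteq> 0" using assms by (auto simp: C_def)
  have "v ?s x \<noteq> 0" by (rule LeastI[of "\<lambda>s. v s x \<noteq> 0", OF s0])
  then obtain s where s: "?s = Suc s" using v_0 by (metis not0_implies_Suc)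
  have 1: "v s x = 0" using not_less_Least[of s "\<lambda>s. v s x \<noteq> 0"] s by simp
  have 2: "v (Suc s) x \<noteq> 0" using \<open>v ?s x \<noteq> 0\<close> s by simp
  then have "enters state s x" using 1 by (auto simp: v_Suc new_val_def split: if_splits)
  then show ?thesis using that 1 by (simp add: v_Suc new_val_def)
qed

lemma G_less: "x \<in> C \<Longrightarrow> e \<in> G x \<Longrightarrow> e < level x"
  by (erule entry) (auto simp: enters_def intro: set_decode_bound)

lemma C_met: "x \<in> C \<Longrightarrow> e \<in> G x \<Longrightarrow> \<exists>s. met state s e x"
  by (frule (1) G_less, erule entry) (auto simp: enters_def)

lemma H_subset_C: "H \<subseteq> C"
proof
  fix x assume "x \<in> H"
  then obtain s where "2 * k < v s x" by (auto simp: H_def)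
  then show "x \<in> C" unfolding C_def by (intro CollectI exI[of _ s]) simp
qed

section \<open>Requirements on the true path\<close>

lemma TP_inf: assumes "e \<in> TP" shows "\<exists>s\<ge>N. good state e s t"
proof -
  obtain s where s: "good state e s (max t N)" using assms by (auto simp: TP_def)
  have "good state e s t" by (rule good_antimono[OF _ s]) simp
  moreover have "N \<le> s" using s by (simp add: good_def)
  ultimately show ?thesis by blast
qed

lemma not_TP: "e \<notin> TP \<Longrightarrow> \<exists>t0. \<forall>s t. good state e s t \<longrightarrow> t < t0"
  unfolding TP_def using good_antimono not_le by blast

lemma TP_met: "e \<in> TP \<Longrightarrow> e < level x \<Longrightarrow> \<exists>s. met state s e x"
  unfolding met_iff TP_def by blast

lemma not_TP_met: "e \<notin> TP \<Longrightarrow> \<exists>t0. \<forall>x\<ge>t0. \<forall>s. \<not> met state s e x"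
  unfolding met_iff using not_TP[of e] by (metis add_lessD1 not_le)

lemma finite_met: "e \<notin> TP \<Longrightarrow> finite {x. \<exists>s. met state s e x}"
proof -
  assume "e \<notin> TP"
  then obtain t0 where "\<forall>x\<ge>t0. \<forall>s. \<not> met state s e x" using not_TP_met by blast
  then have "{x. \<exists>s. met state s e x} \<subseteq> {..<t0}" by (auto simp: not_less[symmetric])
  then show ?thesis using finite_subset by blast
qed

lemma TP_disjoint: assumes "e \<in> TP" shows "x \<notin> W (a_of e) \<or> x \<notin> W (b_of e)"
proof (rule ccontr)
  assume "\<not> ?thesis"
  then obtain s1 s2 where "x \<in> W_at (a_of e) s1" "x \<in> W_at (b_of e) s2"
    unfolding W_eq_UN_W_at by blast
  moreover obtain s where "s \<ge> max s1 s2" "good state e s (x + 1)"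
    using TP_inf[OF assms] by blast
  ultimately show False
    using W_at_mono[of s1 s] W_at_mono[of s2 s] goodD[of e s x] by auto
qed

lemma good_outside: "good state e s (x + 1) \<Longrightarrow> v s x = 0 \<Longrightarrow> x \<in> W (w_of e)"
  using goodD W_at_subset by blast

lemma TP_ab: assumes "e \<in> TP" "x \<in> C" shows "x \<in> W (a_of e) \<or> x \<in> W (b_of e)"
proof -
  obtain s1 where s1: "v s1 x \<noteq> 0" using assms by (auto simp: C_def)
  obtain s where s: "s \<ge> s1" "good state e s (x + 1)" using TP_inf[OF assms(1)] by blast
  have "v s x \<noteq> 0" using s1 v_mono[OF s(1), of x] by auto
  then have "x \<in> W_at (a_of e) s \<or> x \<in> W_at (b_of e) s" using goodD[OF s(2)] by simp
  then show ?thesis using W_at_subset by blast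
qed

text \<open>All facts about \<open>x\<close> are final from some stage on, and agreement recurs
  after it; there the comparison at the stage is the true one.\<close>

lemma TP_BD:
  assumes "e \<in> TP" "x \<in> C" "x \<notin> H" "x \<in> W (a_of e)" "1 \<le> l" "l \<le> k"
  shows "x \<in> BB (i_of e) l \<longleftrightarrow> x \<in> D (i_of e) l"
proof -
  have "\<forall>\<^sub>F s in sequentially. (x \<in> BB_at (i_of e) l s \<longleftrightarrow> x \<in> BB (i_of e) l) \<and>
      (inD state s (i_of e) l x \<longleftrightarrow> x \<in> D (i_of e) l) \<and> (x \<in> W_at (a_of e) s \<longleftrightarrow> x \<in> W (a_of e)) \<and>
      (v s x \<noteq> 0 \<longleftrightarrow> x \<in> C)"
    unfolding D_def C_def mem_Collect_eq
    by (intro eventually_conj eventually_W_at eventually_BB_at eventually_mono_ex)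
      (auto intro: inD_mono dest: v_mono[of _ _ x])
  then obtain N where N: "\<And>s. s \<ge> N \<Longrightarrow> (x \<in> BB_at (i_of e) l s \<longleftrightarrow> x \<in> BB (i_of e) l) \<and>
      (inD state s (i_of e) l x \<longleftrightarrow> x \<in> D (i_of e) l) \<and> (x \<in> W_at (a_of e) s \<longleftrightarrow> x \<in> W (a_of e)) \<and>
      (v s x \<noteq> 0 \<longleftrightarrow> x \<in> C)"
    unfolding eventually_sequentially by blast
  obtain s where s: "s \<ge> N" "good state e s (x + 1)" using TP_inf[OF assms(1)] by blast
  have "v s x \<le> 2 * k" using assms(3) by (auto simp: H_def not_less)
  then show ?thesis using goodD[OF s(2)] N[OF s(1)] assms by blast
qed

text \<open>Conversely, hypotheses true in the limit make each number pass the test from some stage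
  on, hence all numbers below a given \<open>t\<close> at one stage.\<close>

lemma TP_I:
  assumes w: "- C \<subseteq> W w" and ab: "C \<subseteq> W a \<union> W b" "W a \<inter> W b = {}"
    and BD: "\<And>l. 1 \<le> l \<Longrightarrow> l \<le> k \<Longrightarrow> BB i l \<inter> (W a \<inter> C - H) = D i l \<inter> (W a \<inter> C - H)"
  shows "prod_encode (w, prod_encode (i, prod_encode (a, b))) \<in> TP"
proof -
  let ?e = "prod_encode (w, prod_encode (i, prod_encode (a, b)))"
  let ?ok = "\<lambda>x s. (v s x = 0 \<longrightarrow> x \<in> W_at w s) \<and>
     (v s x \<noteq> 0 \<longrightarrow> x \<in> W_at a s \<or> x \<in> W_at b s) \<and>
     \<not> (x \<in> W_at a s \<and> x \<in> W_at b s) \<and>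
     (v s x \<noteq> 0 \<and> v s x \<le> 2 * k \<and> x \<in> W_at a s \<longrightarrow>
       (\<forall>l\<le>k. 1 \<le> l \<longrightarrow> (x \<in> BB_at i l s \<longleftrightarrow> inD state s i l x)))"
  have ev: "\<forall>\<^sub>F s in sequentially. ?ok x s" for x
  proof -
    have "\<forall>\<^sub>F s in sequentially. \<forall>l\<in>{..k}. (x \<in> BB_at i l s \<longleftrightarrow> x \<in> BB i l) \<and>
        (inD state s i l x \<longleftrightarrow> x \<in> D i l)"
      unfolding D_def mem_Collect_eq
      by (intro eventually_ball_finite ballI eventually_conj eventually_BB_at eventually_mono_ex)
        (auto intro: inD_mono)
    moreover have "\<forall>\<^sub>F s in sequentially. (x \<in> W_at a s \<longleftrightarrow> x \<in> W a) \<and> (x \<in> W_at b s \<longleftrightarrow> x \<in> W b) \<and>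
        (x \<in> W_at w s \<longleftrightarrow> x \<in> W w) \<and> (v s x \<noteq> 0 \<longleftrightarrow> x \<in> C) \<and> (2 * k < v s x \<longleftrightarrow> x \<in> H)"
      unfolding C_def H_def mem_Collect_eq
      by (intro eventually_conj eventually_W_at eventually_mono_ex)
        (auto dest: v_mono[of _ _ x])
    ultimately show ?thesis
    proof eventually_elim
      case (elim s)
      have "x \<in> BB_at i l s \<longleftrightarrow> inD state s i l x"
        if "x \<in> W a" "x \<in> C" "x \<notin> H" "1 \<le> l" "l \<le> k" for l
        using elim(1) BD[of l] that by blast
      moreover have "v s x \<le> 2 * k \<longleftrightarrow> x \<notin> H" using elim(2) by linarith
      ultimately show ?case using w ab elim(2) by blast
    qed
  qed
  have "\<exists>s. good state ?e s t" for t
  proof -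
    have "\<forall>\<^sub>F s in sequentially. (\<forall>x\<in>{..<t}. ?ok x s) \<and> t \<le> s"
      by (intro eventually_conj eventually_ball_finite ballI ev eventually_ge_at_top) auto
    then obtain s where "(\<forall>x\<in>{..<t}. ?ok x s) \<and> t \<le> s"
      using eventually_happens'[OF sequentially_bot] by blast
    then show ?thesis unfolding good_def by (intro exI[of _ s]) auto
  qed
  then show ?thesis by (simp add: TP_def)
qed

text \<open>Questions are put in order of decreasing index, and a requirement that is infinitely often
  satisfied answers; hence a round that has reached such requirements only is completed.\<close>

lemma progress:
  assumes s0: "v s0 x = 2 * l" and l: "1 \<le> l" "l \<le> k"
    and above: "\<And>r. q \<le> r \<Longrightarrow> asked state s0 x r \<Longrightarrow> cleared state l s0 x r"
    and below: "\<And>r. r < q \<Longrightarrow> asked state s0 x r \<Longrightarrow> r \<in> TP"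
  shows "\<exists>s\<ge>s0. 2 * l < v s x"
proof (rule ccontr)
  assume "\<not> ?thesis"
  then have v: "v s x = 2 * l" if "s \<ge> s0" for s
    using v_mono[OF that, of x] s0 that by (metis le_antisym not_less)
  have xC: "x \<in> C" using s0 l by (auto simp: C_def intro!: exI[of _ s0])
  have xH: "x \<notin> H"
  proof
    assume "x \<in> H"
    then obtain s where "2 * k < v s x" by (auto simp: H_def)
    moreover have "v (max s s0) x = 2 * l" by (rule v) simp
    ultimately show False using v_mono[of s "max s s0" x] l by linarith
  qed
  \<comment> \<open>Downward induction: starting from \<open>q\<close>, one requirement after the
    other joins those that are cleared.\<close>
  have "q' \<le> q \<Longrightarrow> \<exists>s\<ge>s0. \<forall>r\<ge>q'. asked state s x r \<longrightarrow> cleared state l s x r" for q'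
  proof (induction q' rule: inc_induct)
    case base
    then show ?case using above by blast
  next
    case (step q')
    then obtain s1 where s1: "s1 \<ge> s0" "\<And>r. Suc q' \<le> r \<Longrightarrow> asked state s1 x r \<Longrightarrow> cleared state l s1 x r"
      by blast
    have later: "asked state s x r \<Longrightarrow> cleared state l s x r" if "s \<ge> s1" "Suc q' \<le> r" for s r
      using that s1(2)[of r] asked_antimono[of s1 s x r] cleared_mono[of s1 s l x r] by blast
    have suff: ?case if "s2 \<ge> s1" "asked state s2 x q' \<Longrightarrow> cleared state l s2 x q'" for s2
    proof (intro exI conjI allI impI)
      show "s0 \<le> s2" using that s1 by simp
      fix r assume "q' \<le> r" "asked state s2 x r"
      then show "cleared state l s2 x r" using that later[of s2 r] by (cases "r = q'") auto
    qed
    show ?case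
    proof (cases "\<forall>s\<ge>s1. asked state s x q'")
      case False
      then show ?thesis using suff by blast
    next
      case True
      have TP: "r \<in> TP" if "r \<le> q'" "asked state s1 x r" for r
        using below[of r] that step.hyps s1(1) asked_antimono[of s0 s1 x r] by auto
      have askedT: "asked state s x r" if "s \<ge> s1" "r \<le> q'" "asked state s1 x r" for s r
        using True asked_less[of s x q' s1 r] that by (cases "r = q'") auto
      have q'TP: "q' \<in> TP" using TP[of q'] True by blast
      \<comment> \<open>Were \<open>q'\<close> never cleared, the question would be put on its
        behalf; \<open>x\<close> would enter \<open>D\<close>, and \<open>TP_BD\<close> would
        produce the answer that clears \<open>q'\<close>.\<close>
      have "\<exists>s2\<ge>s1. cleared state l s2 x q'"
      proof (rule ccontr)
        assume no: "\<not> ?thesis"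
        have out: "x \<notin> W (b_of q')"
        proof
          assume "x \<in> W (b_of q')"
          then obtain s where "x \<in> W_at (b_of q') s" unfolding W_eq_UN_W_at by blast
          then have "x \<in> W_at (b_of q') (max s s1)" using W_at_mono[of s "max s s1"] by auto
          then show False using no by (auto simp: cleared_def)
        qed
        then have inq: "x \<in> W (a_of q')" using TP_ab[OF q'TP xC] by blast
        have outr: "x \<in> W (b_of r)" if r: "r < q'" "asked state s1 x r" "i_of r = i_of q'" for r
        proof (rule ccontr)
          assume "x \<notin> W (b_of r)"
          then have "x \<in> W (a_of r)" using TP_ab[OF TP[of r] xC] r by auto
          then obtain s where "x \<in> W_at (a_of r) s" unfolding W_eq_UN_W_at by blast
          then have "x \<in> W_at (a_of r) (max s s1)" using W_at_mono[of s "max s s1"] by auto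
          then have "cleared state l (max s s1) x q'"
            unfolding cleared_def using askedT[of "max s s1" r] r by auto
          then show False using no by auto
        qed
        have "\<forall>\<^sub>F s in sequentially. (x \<in> W_at (a_of q') s \<longleftrightarrow> x \<in> W (a_of q')) \<and>
            (\<forall>r\<in>{..<q'}. x \<in> W_at (b_of r) s \<longleftrightarrow> x \<in> W (b_of r))"
          by (intro eventually_conj eventually_W_at eventually_ball_finite ballI) auto
        then obtain N where N: "\<And>s. s \<ge> N \<Longrightarrow> (x \<in> W_at (a_of q') s \<longleftrightarrow> x \<in> W (a_of q')) \<and>
            (\<forall>r\<in>{..<q'}. x \<in> W_at (b_of r) s \<longleftrightarrow> x \<in> W (b_of r))"
          unfolding eventually_sequentially by blast
        define s where "s = max N s1"
        have s: "s \<ge> N" "s \<ge> s1" "s \<ge> s0" using s1(1) by (auto simp: s_def)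
        have "asks state (i_of q') l s x"
          unfolding asks_def
        proof (intro exI[of _ q'] conjI allI impI)
          show "asked state s x q'" using True s by blast
          then show "q' < level x" by (simp add: asked_def)
          show "i_of q' = i_of q'" ..
          show "x \<in> W_at (a_of q') s" using N[OF s(1)] inq by blast
          show "x \<in> W_at (b_of r) s" if "r < q'" "asked state s x r \<and> i_of r = i_of q'" for r
            using N[OF s(1)] outr[of r] that asked_antimono[OF s(2), of x r] by auto
          show "cleared state l s x r" if "r < level x" "q' < r \<and> asked state s x r" for r
            using later[OF s(2), of r] that by simp
        qed
        then have "inD state (Suc s) (i_of q') l x"
          using v[OF s(3)] l unfolding inD_def by (intro exI[of _ s]) simp
        then have "x \<in> D (i_of q') l" by (auto simp: D_def)
        then have "x \<in> BB (i_of q') l" using TP_BD[OF q'TP xC xH inq l] by blast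
        then obtain s' where "x \<in> BB_at (i_of q') l s'"
          unfolding BB_def BB_at_def W_eq_UN_W_at by blast
        then have "x \<in> BB_at (i_of q') l (max s' s1)" using BB_at_mono[of s' "max s' s1"] by auto
        then show False using no by (auto simp: cleared_def)
      qed
      then show ?thesis using suff by blast
    qed
  qed
  from this[of 0] obtain s where s: "s \<ge> s0" "\<forall>r. asked state s x r \<longrightarrow> cleared state l s x r" by auto
  then have "v (Suc s) x \<noteq> v s x" using v[OF s(1)] l by (auto simp: v_Suc new_val_def)
  then show False using v[of s] v[of "Suc s"] s by simp
qed

subsection \<open>Guesses\<close>

text \<open>Once \<open>e0\<close> has come true, only requirements below \<open>e0\<close> are
  asked, and these are on the true path. A refuted number begins its rounds unprompted and
  \<open>progress\<close> ends them, so its status cannot settle before \<open>H\<close>.\<close>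

lemma refuted_in_H:
  assumes x: "x \<in> C" and e0: "e0 < level x" "e0 \<notin> G x" "e0 \<in> TP"
    and agree: "\<And>e. e < e0 \<Longrightarrow> e \<in> G x \<Longrightarrow> e \<in> TP"
  shows "x \<in> H"
proof (rule ccontr)
  assume xH: "x \<notin> H"
  obtain s1 where s1: "met state s1 e0 x" using TP_met[OF e0(3,1)] by blast
  have asked: "r < e0 \<and> r \<in> TP" if "asked state s x r" "s \<ge> s1" for s r
  proof -
    have "met state s e0 x" using s1 met_mono that by blast
    then have "\<not> e0 < r" "r \<noteq> e0" "r \<in> G x" using that e0 by (auto simp: asked_def)
    then show ?thesis using agree[of r] by auto
  qed
  have ref: "refuted state s x" if "s \<ge> s1" for s
    using s1 e0 met_mono[OF that] by (auto simp: refuted_def)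
  obtain s2 where s2: "s2 \<ge> s1" "\<And>s. s \<ge> s2 \<Longrightarrow> v s x = v s2 x" using v_stable[of s1 x] by blast
  obtain s3 where "v s3 x \<noteq> 0" using x by (auto simp: C_def)
  then have n0: "v s2 x \<noteq> 0"
    using s2(2)[of "max s2 s3"] v_mono[of s3 "max s2 s3" x] by auto
  have le: "v s2 x \<le> 2 * k" using xH by (auto simp: H_def not_less)
  have "v (Suc s2) x = v s2 x" using s2(2)[of "Suc s2"] by simp
  then have "even (v s2 x)" using n0 le ref[OF s2(1)] by (auto simp: v_Suc new_val_def split: if_splits)
  then obtain l where l: "v s2 x = 2 * l" by blast
  have "\<exists>s\<ge>s2. 2 * l < v s x"
  proof (rule progress)
    show "v s2 x = 2 * l" "1 \<le> l" "l \<le> k" using l n0 le by simp_all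
    show "cleared state l s2 x r" if "e0 \<le> r" "asked state s2 x r" for r
      using asked[OF that(2) s2(1)] that(1) by simp
    show "r \<in> TP" if "asked state s2 x r" for r using asked[OF that s2(1)] by simp
  qed
  then obtain s where "s \<ge> s2" "2 * l < v s x" by blast
  then show False using s2(2)[of s] l by simp
qed

definition right :: "nat \<Rightarrow> nat \<Rightarrow> bool" where
  "right n x \<longleftrightarrow> level x = n \<and> (\<forall>e<n. e \<in> G x \<longleftrightarrow> e \<in> TP)"

lemma met_bound: "\<exists>T. \<forall>x\<ge>T. \<forall>e<n. e \<notin> TP \<longrightarrow> (\<forall>s. \<not> met state s e x)"
proof (induction n)
  case (Suc n)
  then obtain T where T: "\<forall>x\<ge>T. \<forall>e<n. e \<notin> TP \<longrightarrow> (\<forall>s. \<not> met state s e x)" by blast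
  obtain t0 where t0: "n \<notin> TP \<longrightarrow> (\<forall>x\<ge>t0. \<forall>s. \<not> met state s n x)" using not_TP_met by blast
  show ?case using T t0 by (intro exI[of _ "max T t0"]) (auto simp: less_Suc_eq)
qed auto

lemma right_same:
  assumes "right n x" "right n y" "x \<in> C" "y \<in> C" shows "guess x = guess y"
proof -
  have "e \<in> G x \<longleftrightarrow> e \<in> G y" for e
    using assms G_less[of x e] G_less[of y e] unfolding right_def by metis
  then have "G x = G y" by blast
  then show ?thesis by (metis set_decode_inverse)
qed

text \<open>Beyond \<open>T\<close> a number with the correct guess is never refuted; once in
  \<open>C\<close> it excludes all later candidates with its level and guess.\<close>

lemma finite_right: "finite {x \<in> C. right n x}"
proof -
  obtain T where T: "\<And>x e s. x \<ge> T \<Longrightarrow> e < n \<Longrightarrow> e \<notin> TP \<Longrightarrow> \<not> met state s e x"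
    using met_bound by blast
  show ?thesis
  proof (cases "\<exists>x\<ge>T. x \<in> C \<and> right n x")
    case False
    then have "{x \<in> C. right n x} \<subseteq> {..<T}" by (auto simp: not_le[symmetric])
    then show ?thesis using finite_subset by blast
  next
    case True
    then obtain x where x: "x \<ge> T" "x \<in> C" "right n x" by blast
    have ref: "\<not> refuted state s x" for s
      using T[OF x(1)] x(3) by (auto simp: refuted_def right_def)
    obtain s0 where s0: "v s0 x \<noteq> 0" using x by (auto simp: C_def)
    \<comment> \<open>A candidate enters only at a stage above itself; for \<open>y\<close> from
      \<open>s0 + x\<close> on, this stage exceeds \<open>s0\<close> and \<open>x\<close>, when
      \<open>x\<close> is an unrefuted rival.\<close>
    have "y < s0 + x" if y: "y \<in> C" "right n y" for y
    proof (rule ccontr)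
      assume "\<not> y < s0 + x"
      obtain s where s: "v s y = 0" "enters state s y" using entry[OF y(1)] by metis
      then have "y < s" by (simp add: enters_def)
      then have "s0 \<le> s" "x < s" using \<open>\<not> y < s0 + x\<close> by auto
      then have "v s x \<noteq> 0" using s0 v_mono[of s0 s x] by auto
      moreover have "level x = level y" "guess x = guess y"
        using right_same[OF x(3) y(2) x(2) y(1)] x(3) y(2) by (auto simp: right_def)
      ultimately have "refuted state s x" using s(2) \<open>x < s\<close> by (auto simp: enters_def)
      then show False using ref by blast
    qed
    then have "{y \<in> C. right n y} \<subseteq> {..<s0 + x}" by auto
    then show ?thesis using finite_subset by blast
  qed
qed

text \<open>Otherwise every number of \<open>C\<close> with the correct guess is below
  \<open>T\<close> and eventually refuted; then nothing stops a number above \<open>T\<close> with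
  that guess from entering.\<close>

lemma witness: "\<exists>x\<in>C. right n x \<and> (\<forall>s. \<not> refuted state s x)"
proof (rule ccontr)
  assume no: "\<not> ?thesis"
  obtain T where T: "\<And>x e s. x \<ge> T \<Longrightarrow> e < n \<Longrightarrow> e \<notin> TP \<Longrightarrow> \<not> met state s e x"
    using met_bound by blast
  have small: "y < T" if "y \<in> C" "right n y" for y
  proof (rule ccontr)
    assume "\<not> y < T"
    then have "\<not> refuted state s y" for s
      using T[of y] that by (auto simp: refuted_def right_def)
    then show False using no that by blast
  qed
  define a where "a = set_encode {e. e < n \<and> e \<in> TP}"
  \<comment> \<open>The third component makes \<open>x\<close> at least \<open>T\<close>.\<close>
  define x where "x = prod_encode (n, prod_encode (a, T))"
  have a: "a < 2 ^ n" unfolding a_def by (rule set_encode_bound) auto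
  have xT: "x \<ge> T" unfolding x_def by (meson le_prod_encode_2 order_trans)
  have lx: "level x = n" "guess x = a" by (simp_all add: x_def)
  have Gx: "G x = {e. e < n \<and> e \<in> TP}" by (simp add: lx a_def)
  have rx: "right n x" by (simp add: right_def lx(1) Gx)
  have xC: "x \<notin> C" using small[OF _ rx] xT by auto
  have "\<forall>\<^sub>F s in sequentially. (\<forall>e\<in>{..<n}. met state s e x \<longleftrightarrow> (\<exists>s. met state s e x)) \<and>
      (\<forall>y\<in>{..<T}. refuted state s y \<longleftrightarrow> (\<exists>s. refuted state s y)) \<and> x < s"
    by (intro eventually_conj eventually_ball_finite ballI eventually_gt_at_top eventually_mono_ex)
      (auto intro: met_mono refuted_mono)
  then obtain s where "(\<forall>e\<in>{..<n}. met state s e x \<longleftrightarrow> (\<exists>s. met state s e x)) \<and>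
      (\<forall>y\<in>{..<T}. refuted state s y \<longleftrightarrow> (\<exists>s. refuted state s y)) \<and> x < s"
    using eventually_happens'[OF sequentially_bot] by blast
  then have s: "\<And>e. e < n \<Longrightarrow> met state s e x \<longleftrightarrow> (\<exists>s. met state s e x)"
     "\<And>y. y < T \<Longrightarrow> refuted state s y \<longleftrightarrow> (\<exists>s. refuted state s y)" "x < s"
    by blast+
  have "enters state s x"
    unfolding enters_def lx
  proof (intro conjI allI impI)
    show "x < s" "a < 2 ^ n" by fact+
  next
    fix e assume "e < n"
    then show "e \<in> set_decode a \<longleftrightarrow> met state s e x"
      using s(1)[of e] T[OF xT, of e] TP_met[of e x] by (auto simp: a_def lx(1))
  next
    fix y assume "y < s" and y: "val state s y \<noteq> 0 \<and> level y = n \<and> guess y = a"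
    then have "y \<in> C" "right n y" using rx lx by (auto simp: C_def right_def)
    then show "refuted state s y" using no s(2)[OF small] by blast
  qed
  moreover have "v s x = 0" using xC by (simp add: C_def)
  ultimately have "v (Suc s) x \<noteq> 0" by (simp add: v_Suc new_val_def)
  then show False using xC by (auto simp: C_def)
qed

text \<open>Witnesses at odd levels are neither refuted nor triggered, so they never get beyond
  status 1.\<close>

lemma infinite_C_H: "infinite (C - H)"
proof -
  obtain w where w: "\<And>n. w n \<in> C" "\<And>n. right n (w n)" "\<And>n s. \<not> refuted state s (w n)"
    using witness by metis
  have "w (2 * n + 1) \<notin> H" for n
  proof -
    have "level (w (2 * n + 1)) = 2 * n + 1" using w(2) by (simp add: right_def)
    then have le: "v s (w (2 * n + 1)) \<le> 1" for s
      by (induction s) (use w(3) k1 in \<open>auto simp: v_0 v_Suc new_val_def trigger_def le_Suc_eq\<close>)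
    have "\<not> 2 * k < v s (w (2 * n + 1))" for s using le[of s] k1 by linarith
    then show ?thesis unfolding H_def by blast
  qed
  then have "range (\<lambda>n. w (2 * n + 1)) \<subseteq> C - H" using w(1) by blast
  moreover have "inj (\<lambda>n. w (2 * n + 1))"
    using w(2) by (intro injI) (metis add_right_cancel mult_cancel1 right_def zero_neq_numeral)
  ultimately show ?thesis using finite_subset finite_imageD infinite_UNIV_nat by metis
qed

section \<open>The sets \<open>A\<close> and \<open>Y\<close>\<close>

definition A :: "nat set" where "A = {x. \<exists>s. v s x = 2 * k + 2}"
definition Y :: "nat set" where "Y = {x. \<exists>s. v s x = 2 * k + 1}"

lemma ce_C: "ce C"
  unfolding C_def by (rule ceI) (intro comp)

lemma ce_A: "ce A"
  unfolding A_def by (rule ceI) (intro comp)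

lemma ce_Y: "ce Y"
  unfolding Y_def by (rule ceI) (intro comp)

lemma ce_D: "ce (D i l)"
  unfolding D_def by (rule ceI) (intro comp)

lemma H_eq: "H = A \<union> Y"
proof -
  have "2 * k < v s x \<longleftrightarrow> v s x = 2 * k + 1 \<or> v s x = 2 * k + 2" for s x
    using v_le[of s x] by linarith
  then show ?thesis unfolding H_def A_def Y_def by auto
qed

lemma A_Y_disjoint: "A \<inter> Y = {}"
proof -
  have "v s x \<noteq> 2 * k + 2" if "v s' x = 2 * k + 1" for s s' x
    using v_final[of s' s x] v_mono[of s s' x] that by (cases "s' \<le> s") auto
  then show ?thesis by (auto simp: A_def Y_def)
qed

lemma Y_even: "even m \<Longrightarrow> Y = {}"
proof -
  assume "even m"
  then have "v s x \<noteq> 2 * k + 1" for s x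
  proof (induction s)
    case (Suc s)
    have "v (Suc s) x \<noteq> 2 * k + 1" if "v s x = 2 * k"
      using that k1 \<open>even m\<close> by (simp add: v_Suc new_val_def)
    then show ?case using Suc v_step[of s x] by auto
  qed (simp add: v_0)
  then show ?thesis by (simp add: Y_def)
qed

lemma D_subset_C: "1 \<le> l \<Longrightarrow> D i l \<subseteq> C"
proof
  fix x assume "1 \<le> l" "x \<in> D i l"
  then obtain s where "2 * l \<le> v s x" by (auto simp: D_def inD_def)
  then show "x \<in> C" using \<open>1 \<le> l\<close> unfolding C_def by (intro CollectI exI[of _ s]) simp
qed

lemma D_antimono: "l \<le> l' \<Longrightarrow> D i l' \<subseteq> D i l"
proof
  fix x assume "l \<le> l'" "x \<in> D i l'"
  then obtain s s' where "s' < s" "even (v s' x)" "2 * l' \<le> v s' x" "v s' x \<le> 2 * k"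
    "asks state i (v s' x div 2) s' x" by (auto simp: D_def inD_def)
  moreover have "2 * l \<le> 2 * l'" using \<open>l \<le> l'\<close> by simp
  ultimately have "inD state s i l x" unfolding inD_def by (intro exI[of _ s']) simp
  then show "x \<in> D i l" by (auto simp: D_def)
qed

section \<open>The set \<open>H\<close> is a major subset of \<open>C\<close>\<close>

lemma finite_exceptions:
  "finite {x \<in> C. (\<exists>e'\<le>e. e' \<notin> TP \<and> (\<exists>s. met state s e' x)) \<or> (\<exists>n\<le>e. right n x)}"
proof -
  have "finite ((\<Union>e'\<in>{e'. e' \<le> e \<and> e' \<notin> TP}. {x. \<exists>s. met state s e' x}) \<union>
      (\<Union>n\<in>{..e}. {x \<in> C. right n x}))"
    using finite_met finite_right by auto
  then show ?thesis by (rule rev_finite_subset) auto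
qed

text \<open>The requirement \<open>e\<close> for \<open>w\<close> and the splitting of
  \<open>C\<close> into the empty set and \<open>C\<close> is true. If it belongs to the guess of
  \<open>x\<close>, it came true while \<open>x\<close> was outside \<open>C\<close>, which demanded
  \<open>x \<in> W w\<close>. A guess that goes wrong up to \<open>e\<close> first omits a true
  requirement, and then \<open>x\<close> is in \<open>H\<close>, or contains a false one, for
  finitely many \<open>x\<close> only; correct guesses at levels up to \<open>e\<close> are finite
  in number, too.\<close>

lemma major:
  assumes w: "- C \<subseteq> W w" shows "finite (- H - W w)"
proof -
  obtain a b where ab: "W a = {}" "W b = C"
    using ce_finite[of "{}"] ce_C unfolding ce_def by auto
  define e where "e = prod_encode (w, prod_encode (0, prod_encode (a, b)))"
  have e: "e \<in> TP" unfolding e_def by (rule TP_I) (use ab w in auto)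
  have we: "w_of e = w" by (simp add: e_def)
  have "- H - W w \<subseteq> {x \<in> C. (\<exists>e'\<le>e. e' \<notin> TP \<and> (\<exists>s. met state s e' x)) \<or> (\<exists>n\<le>e. right n x)}"
  proof
    fix x assume x: "x \<in> - H - W w"
    then have xC: "x \<in> C" using w by blast
    show "x \<in> {x \<in> C. (\<exists>e'\<le>e. e' \<notin> TP \<and> (\<exists>s. met state s e' x)) \<or> (\<exists>n\<le>e. right n x)}"
    proof (cases "\<exists>e'. e' \<le> e \<and> e' < level x \<and> (e' \<in> G x) \<noteq> (e' \<in> TP)")
      case True
      define e0 where "e0 = (LEAST e'. e' \<le> e \<and> e' < level x \<and> (e' \<in> G x) \<noteq> (e' \<in> TP))"
      have e0: "e0 \<le> e" "e0 < level x" "(e0 \<in> G x) \<noteq> (e0 \<in> TP)"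
        using LeastI_ex[OF True] unfolding e0_def by blast+
      have below: "e' \<in> TP" if "e' < e0" "e' \<in> G x" for e'
        using not_less_Least[of e' "\<lambda>e'. e' \<le> e \<and> e' < level x \<and> (e' \<in> G x) \<noteq> (e' \<in> TP)"]
          that e0 unfolding e0_def[symmetric] by auto
      have "e0 \<in> G x"
      proof (rule ccontr)
        assume "e0 \<notin> G x"
        then show False using refuted_in_H[OF xC e0(2) _ _ below] e0(3) x by blast
      qed
      then show ?thesis using C_met[OF xC] e0 xC by blast
    next
      case False
      show ?thesis
      proof (cases "e < level x")
        case True
        then have "e \<in> G x" using False e by blast
        obtain s where s: "v s x = 0" "enters state s x" using entry[OF xC] by metis
        then have "met state s e x" using True \<open>e \<in> G x\<close> by (auto simp: enters_def)
        then obtain s' where s': "s' < s" "good state e s' (x + 1)" by (auto simp: met_iff)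
        then have "v s' x = 0" using s(1) v_mono[of s' s x] by simp
        then show ?thesis using good_outside[OF s'(2)] x we by blast
      next
        case False2: False
        then have "right (level x) x" using False by (auto simp: right_def)
        then show ?thesis using xC False2 by auto
      qed
    qed
  qed
  then show ?thesis using finite_exceptions finite_subset by blast
qed

text \<open>Leaving round \<open>l\<close> takes an answer of the chain: the least true requirement
  with this chain and \<open>x\<close> in its half can be cleared in no other way. Conversely, an
  answer outside \<open>H\<close> shows that the question was put, and \<open>progress\<close>
  carries \<open>x\<close> on.\<close>

lemma round_iff:
  assumes e: "e \<in> TP" and asked: "\<And>s r. r \<le> e \<Longrightarrow> asked state s x r \<longleftrightarrow> r \<in> TP"
    and xa: "x \<in> W (a_of e)" and l: "1 \<le> l" "l \<le> k"
    and s0: "2 * l - 1 \<le> v s0 x" "v s0 x \<le> 2 * k"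
  shows "x \<in> H \<or> (\<exists>s. 2 * l + 1 \<le> v s x \<and> v s x \<le> 2 * k) \<longleftrightarrow> x \<in> BB (i_of e) l"
proof
  assume "x \<in> H \<or> (\<exists>s. 2 * l + 1 \<le> v s x \<and> v s x \<le> 2 * k)"
  moreover have "2 * l + 1 \<le> v s x" if "2 * k < v s x" for s using that l by simp
  ultimately have ex: "\<exists>s. 2 * l + 1 \<le> v s x" unfolding H_def by blast
  define s1 where "s1 = (LEAST s. 2 * l + 1 \<le> v s x)"
  have s1: "2 * l + 1 \<le> v s1 x" using LeastI_ex[OF ex] by (simp add: s1_def)
  then obtain s where s: "s1 = Suc s" using v_0[of x] by (cases s1) auto
  have le: "v s x \<le> 2 * l"
    using not_less_Least[of s "\<lambda>s. 2 * l + 1 \<le> v s x"] s s1_def by simp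
  \<comment> \<open>A jump into \<open>A\<close> from an earlier round would come after
    \<open>s0\<close>, when the status is already at least \<open>2 * l - 1\<close>.\<close>
  have eq: "v s x = 2 * l"
  proof (rule ccontr)
    assume neq: "v s x \<noteq> 2 * l"
    have jump: "even (v s x)" "v (Suc s) x = 2 * k + 2"
      using v_step[of s x] s1 le neq s by auto
    have "v s x \<le> 2 * l - 2" using jump(1) le neq by auto
    moreover have "s \<ge> s0"
    proof (rule ccontr)
      assume "\<not> s \<ge> s0"
      then have "v (Suc s) x \<le> v s0 x" by (intro v_mono) simp
      then show False using jump(2) s0 by simp
    qed
    then have "v s0 x \<le> v s x" by (rule v_mono)
    ultimately show False using s0 l by simp
  qed
  have cl: "cleared state l s x r" if "asked state s x r" for r
  proof -
    have "r < level x" using that by (simp add: asked_def)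
    then show ?thesis using s1 s eq l that by (auto simp: v_Suc new_val_def split: if_splits)
  qed
  let ?P = "\<lambda>r. r \<le> e \<and> r \<in> TP \<and> i_of r = i_of e \<and> x \<in> W (a_of r)"
  define r where "r = (LEAST r. ?P r)"
  have r: "?P r" unfolding r_def by (rule LeastI[of ?P e]) (use e xa in auto)
  have min: "\<not> ?P r'" if "r' < r" for r' using not_less_Least[of r' ?P] that by (simp add: r_def)
  have "cleared state l s x r" using cl asked[of r s] r by blast
  then show "x \<in> BB (i_of e) l"
    unfolding cleared_def
  proof (elim disjE exE conjE)
    assume "x \<in> W_at (b_of r) s"
    then show ?thesis using TP_disjoint[of r x] r W_at_subset by blast
  next
    fix r' assume r': "r' < r" "asked state s x r'" "i_of r' = i_of r" "x \<in> W_at (a_of r') s"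
    have "r' \<le> e" using r' r by simp
    then have "r' \<in> TP" using asked[of r' s] r'(2) by simp
    then show ?thesis using min[OF r'(1)] r r' W_at_subset[of "a_of r'" s] by auto
  next
    assume "x \<in> BB_at (i_of r) l s"
    then show ?thesis using r BB_at_subset by auto
  qed
next
  assume B: "x \<in> BB (i_of e) l"
  have "v s0 x \<noteq> 0" using s0 l by auto
  then have xC: "x \<in> C" by (auto simp: C_def)
  show "x \<in> H \<or> (\<exists>s. 2 * l + 1 \<le> v s x \<and> v s x \<le> 2 * k)"
  proof (cases "x \<in> H")
    case False
    then have le: "v s x \<le> 2 * k" for s by (auto simp: H_def not_less)
    have "x \<in> D (i_of e) l" using TP_BD[OF e xC False xa l] B by blast
    then obtain s where s: "even (v s x)" "2 * l \<le> v s x" "asks state (i_of e) (v s x div 2) s x"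
      by (auto simp: D_def inD_def)
    show ?thesis
    proof (cases "v s x = 2 * l")
      case True
      obtain r where r: "asked state s x r" "i_of r = i_of e"
        "\<And>r'. r' < r \<Longrightarrow> asked state s x r' \<Longrightarrow> i_of r' = i_of e \<Longrightarrow> x \<in> W_at (b_of r') s"
        "\<And>r'. r' < level x \<Longrightarrow> r < r' \<Longrightarrow> asked state s x r' \<Longrightarrow> cleared state l s x r'"
        using s(3) unfolding asks_def True by auto
      \<comment> \<open>A larger \<open>r\<close> would have had to wait for \<open>x\<close> to
        appear in \<open>W (b_of e)\<close>, which is disjoint from
        \<open>W (a_of e)\<close>.\<close>
      have re: "r \<le> e"
      proof (rule ccontr)
        assume "\<not> r \<le> e"
        then have "x \<in> W_at (b_of e) s" using r(3)[of e] asked[of e s] e by simp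
        then show False using TP_disjoint[OF e, of x] xa W_at_subset by blast
      qed
      have "\<exists>s'\<ge>s. 2 * l < v s' x"
      proof (rule progress[OF True l])
        show "cleared state l s x r'" if "Suc r \<le> r'" "asked state s x r'" for r'
          using r(4)[of r'] that by (simp add: asked_def)
        show "r' \<in> TP" if "r' < Suc r" "asked state s x r'" for r'
          using asked[of r' s] that re by simp
      qed
      then show ?thesis using le by (metis Suc_eq_plus1 Suc_leI)
    next
      case False
      then show ?thesis using s le[of s] by (intro disjI2 exI[of _ s]) auto
    qed
  qed simp
qed

text \<open>Numbers still outside \<open>C\<close> after agreement of the true requirements up to
  \<open>e\<close> has covered them can enter \<open>C\<close> only with a guess correct up to
  \<open>e\<close>; minus finitely many exceptions they form \<open>T 1\<close>. The later sets
  record how far the rounds have gone, so that \<open>round_iff\<close> becomes the equations of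
  \<open>Psi\<close>.\<close>

lemma psi_chain:
  assumes e: "e \<in> TP" and ab: "W (a_of e) \<subseteq> C"
  shows "\<exists>T. ce_chain k T \<and> - C \<subseteq> T 1 \<and>
    (\<forall>l x. 1 \<le> l \<and> l \<le> k \<and> x \<in> W (a_of e) \<inter> T l \<longrightarrow>
      (x \<in> H \<or> (l < k \<and> x \<in> T (l + 1)) \<longleftrightarrow> x \<in> BB (i_of e) l))"
proof -
  define F where "F = {x \<in> C. (\<exists>e'\<le>e. e' \<notin> TP \<and> (\<exists>s. met state s e' x)) \<or> (\<exists>n\<le>e. right n x)}"
  define V where "V e' = (if e' \<in> TP then {x. \<exists>s. v s x = 0 \<and> (\<exists>s'<s. good state e' s' (x + 1))} else UNIV)" for e'
  define T1 where "T1 = {x. \<forall>e'<Suc e. x \<in> V e'} - F"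
  \<comment> \<open>The cap \<open>2 * k\<close> keeps out numbers that reach the required status
    only by jumping into \<open>H\<close>.\<close>
  define T where "T l = (if l \<le> 1 then T1 else T1 \<inter> {x. \<exists>s. 2 * l - 1 \<le> v s x \<and> v s x \<le> 2 * k})" for l
  have ceV: "ce (V e')" for e'
  proof -
    have "ce {x. \<exists>s. v s x = 0 \<and> (\<exists>s'<s. good state e' s' (x + 1))}"
      by (rule ceI) (intro comp)
    then show ?thesis by (simp add: V_def ce_UNIV)
  qed
  have ceT1: "ce T1"
    unfolding T1_def F_def by (intro ce_Diff_finite ce_ball_less ceV finite_exceptions)
  have "ce {x. \<exists>s. 2 * l - 1 \<le> v s x \<and> v s x \<le> 2 * k}" for l
    by (rule ceI) (intro comp)
  then have ceT: "ce (T l)" for l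
    unfolding T_def using ceT1 ce_Int by simp
  have anti: "T (l + 1) \<subseteq> T l" for l
    unfolding T_def by (auto intro: order_trans[rotated])
  have chain: "ce_chain k T" unfolding ce_chain_def using ceT anti by blast
  have C1: "- C \<subseteq> T 1"
  proof
    fix x assume x: "x \<in> - C"
    then have v: "v s x = 0" for s by (simp add: C_def)
    have "x \<in> V e'" for e'
      unfolding V_def using v by (auto simp: TP_def) (metis lessI)
    then show "x \<in> T 1" using x by (simp add: T_def T1_def F_def)
  qed
  have asked: "asked state s x r \<longleftrightarrow> r \<in> TP" if x: "x \<in> C" "x \<in> T1" and r: "r \<le> e" for x s r
  proof -
    obtain s1 where s1: "v s1 x = 0" "v (Suc s1) x = 1" "enters state s1 x" using entry[OF x(1)] .
    have xF: "\<not> met state s e' x" if "e' \<le> e" "e' \<notin> TP" for e' s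
      using x that by (auto simp: T1_def F_def)
    have agree: "e' \<in> G x \<longleftrightarrow> e' \<in> TP" if e': "e' \<le> e" "e' < level x" for e'
    proof
      assume "e' \<in> G x"
      then show "e' \<in> TP" using C_met[OF x(1)] xF[OF e'(1)] by blast
    next
      assume "e' \<in> TP"
      moreover have "x \<in> V e'" using x(2) e'(1) by (simp add: T1_def)
      ultimately obtain s2 s' where s2: "v s2 x = 0" "s' < s2" "good state e' s' (x + 1)"
        by (auto simp: V_def)
      \<comment> \<open>At \<open>s2\<close> the number is still outside \<open>C\<close>, so its
        entry comes no earlier and finds \<open>e'\<close> met.\<close>
      have "s2 \<le> s1" using v_mono[of "Suc s1" s2 x] s1(2) s2(1) by (cases "s2 \<le> s1") auto
      then have "met state s1 e' x" using s2 e'(2) less_le_trans unfolding met_iff by blast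
      then show "e' \<in> G x" using s1(3) e'(2) by (auto simp: enters_def)
    qed
    \<comment> \<open>A number of level at most \<open>e\<close> would have an entirely correct
      guess and be one of the exceptions.\<close>
    have "e < level x"
    proof (rule ccontr)
      assume n: "\<not> e < level x"
      then have "right (level x) x" using agree by (auto simp: right_def)
      then show False using x n by (auto simp: T1_def F_def)
    qed
    then show ?thesis unfolding asked_def using agree xF r by auto
  qed
  have main: "x \<in> H \<or> (l < k \<and> x \<in> T (l + 1)) \<longleftrightarrow> x \<in> BB (i_of e) l"
    if l: "1 \<le> l" "l \<le> k" and x: "x \<in> W (a_of e) \<inter> T l" for l x
  proof -
    have xC: "x \<in> C" and xT: "x \<in> T1" using x ab by (auto simp: T_def split: if_splits)
    have "\<exists>s. 2 * l - 1 \<le> v s x \<and> v s x \<le> 2 * k"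
    proof (cases "l = 1")
      case True
      obtain s where "v (Suc s) x = 1" using entry[OF xC] by blast
      then show ?thesis using True k1 by (intro exI[of _ "Suc s"]) simp
    next
      case False
      then show ?thesis using x l by (auto simp: T_def)
    qed
    then obtain s where s: "2 * l - 1 \<le> v s x" "v s x \<le> 2 * k" by blast
    \<comment> \<open>For \<open>l = k\<close> both sides are false.\<close>
    have "l < k \<and> x \<in> T (l + 1) \<longleftrightarrow> (\<exists>s. 2 * l + 1 \<le> v s x \<and> v s x \<le> 2 * k)"
      using xT l by (auto simp: T_def)
    then show ?thesis using round_iff[OF e asked[OF xC xT] _ l s] x by simp
  qed
  show ?thesis using chain C1 main by (intro exI[of _ T]) blast
qed

lemma major_H: "major_subset H C"
  unfolding major_subset_def using H_subset_C infinite_C_H major by blast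

subsection \<open>The property Q\<close>

text \<open>The program for a given chain disregards its own index and finds the sets in a
  hard-wired table.\<close>

lemma chain_index:
  assumes "\<And>l. 1 \<le> l \<Longrightarrow> l \<le> k \<Longrightarrow> ce (B l)"
  obtains i where "\<And>l. 1 \<le> l \<Longrightarrow> l \<le> k \<Longrightarrow> BB i l = B l"
proof -
  obtain g where g: "\<And>l. 1 \<le> l \<Longrightarrow> l \<le> k \<Longrightarrow> B l = W (g l)" using assms unfolding ce_def by metis
  let ?g = "\<lambda>l. if l < Suc k then g l else 0"
  have "decidable (\<lambda>w. p2 (p2 (p1 w)) \<in> W_at (?g (p1 (p2 (p1 w)))) (p2 w))"
    by (intro dec_W_at comp_comp[OF comp_finite_table, of "\<lambda>w. p1 (p2 (p1 w))"] comp)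
  from semidecidable[OF this] obtain i
    where "W i = {z. \<exists>u. p2 (p2 z) \<in> W_at (?g (p1 (p2 z))) u}" by blast
  then have "BB i l = W (?g l)" for l unfolding BB_def W_eq_UN_W_at by auto
  then have "BB i l = B l" if "1 \<le> l" "l \<le> k" for l using g[OF that] that by simp
  then show ?thesis by (rule that)
qed

text \<open>The response \<open>D i\<close> depends only on an index of \<open>B\<close>, hence it
  is chosen before \<open>S\<close>. Each splitting has a requirement of its own, which
  \<open>Phi\<close> makes true.\<close>

lemma Q_even_H: "Q_even k H"
  unfolding Q_even_def
proof (intro exI[of _ C] conjI allI impI)
  show "ce C" "major_subset H C" by (rule ce_C, rule major_H)
  fix B assume B: "ce_chain k B \<and> B 1 \<subseteq> C"
  then obtain i where i: "\<And>l. 1 \<le> l \<Longrightarrow> l \<le> k \<Longrightarrow> BB i l = B l"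
    using chain_index[of B] unfolding ce_chain_def by blast
  have "\<exists>T. ce_chain k T \<and> - C \<subseteq> T 1 \<and> (Phi k H B (D i) S \<longrightarrow> Psi k H B S T)"
    if S: "ce S \<and> splits S C" for S
  proof (cases "Phi k H B (D i) S")
    case False
    then show ?thesis
      by (intro exI[of _ "\<lambda>_. UNIV"]) (simp add: ce_chain_def ce_UNIV)
  next
    case True
    obtain a b where ab: "S = W a" "W a \<union> W b = C" "W a \<inter> W b = {}"
      using S unfolding splits_def ce_def by auto
    obtain w where w: "W w = UNIV" using ce_UNIV unfolding ce_def by metis
    define e where "e = prod_encode (w, prod_encode (i, prod_encode (a, b)))"
    have e: "i_of e = i" "a_of e = a" by (simp_all add: e_def)
    have "e \<in> TP" unfolding e_def
    proof (rule TP_I)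
      fix l assume "1 \<le> l" "l \<le> k"
      then show "BB i l \<inter> (W a \<inter> C - H) = D i l \<inter> (W a \<inter> C - H)"
        using True i[of l] ab unfolding Phi_def by blast
    qed (use w ab in auto)
    have "W (a_of e) \<subseteq> C" using ab e by blast
    from psi_chain[OF \<open>e \<in> TP\<close> this] obtain T where T': "ce_chain k T \<and> - C \<subseteq> T 1 \<and>
      (\<forall>l x. 1 \<le> l \<and> l \<le> k \<and> x \<in> W a \<inter> T l \<longrightarrow>
        (x \<in> H \<or> (l < k \<and> x \<in> T (l + 1)) \<longleftrightarrow> x \<in> BB i l))"
      unfolding e by (elim exE)
    then have T: "ce_chain k T" "- C \<subseteq> T 1" by simp_all
    have psi: "x \<in> H \<or> (l < k \<and> x \<in> T (l + 1)) \<longleftrightarrow> x \<in> BB i l"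
      if "1 \<le> l" "l \<le> k" "x \<in> W a" "x \<in> T l" for l x
      using T' that by simp
    have "Psi k H B S T"
      unfolding Psi_def ab(1)
    proof (intro conjI allI impI)
      fix l assume l: "1 \<le> l \<and> l < k"
      then show "(H \<union> T (l + 1)) \<inter> (W a \<inter> T l) = B l \<inter> (W a \<inter> T l)"
        using psi[of l] i[of l] by auto
    next
      show "H \<inter> (W a \<inter> T k) = B k \<inter> (W a \<inter> T k)"
        using psi[of k] i[of k] k1 by auto
    qed
    then show ?thesis using T by blast
  qed
  moreover have "ce_chain k (D i)"
    unfolding ce_chain_def using ce_D D_antimono by simp
  ultimately show "\<exists>D. ce_chain k D \<and> D 1 \<subseteq> C \<and> (\<forall>S. ce S \<and> splits S C \<longrightarrow>
      (\<exists>T. ce_chain k T \<and> - C \<subseteq> T 1 \<and> (Phi k H B D S \<longrightarrow> Psi k H B S T)))"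
    using D_subset_C[of 1 i] by (intro exI[of _ "D i"]) blast
qed

lemma Q_A: "Q m A"
proof (cases "even m")
  case True
  then have "H = A" using H_eq Y_even by simp
  then show ?thesis using Q_even_H True by (simp add: Q_def k[symmetric])
next
  case False
  have "Q_even k (A \<union> Y)" using Q_even_H H_eq by simp
  moreover have "Y \<subseteq> - A" using A_Y_disjoint by blast
  ultimately show ?thesis using False ce_Y unfolding Q_def k[symmetric] by auto
qed

subsection \<open>Tardiness\<close>

definition A_at :: "nat \<Rightarrow> nat set" where "A_at s = {x. v s x = 2 * k + 2}"

lemma A_at_mono: "s \<le> s' \<Longrightarrow> A_at s \<subseteq> A_at s'"
  using v_final[of s s'] by (auto simp: A_at_def)

lemma A_at_subset: "A_at s \<subseteq> A"
  by (auto simp: A_at_def A_def)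

lemma A_at_less: "x \<in> A_at s \<Longrightarrow> x < s"
  using v_bound[of s x] by (auto simp: A_at_def not_le[symmetric])

lemma dec_A_at: "computable x \<Longrightarrow> computable s \<Longrightarrow> decidable (\<lambda>z. x z \<in> A_at (s z))"
  unfolding A_at_def mem_Collect_eq by (intro comp)

lemma enumeration_A: "computable_enumeration A_at A"
  unfolding computable_enumeration_def
proof (intro conjI allI)
  have "computable (\<lambda>s. \<Sum>x<s. of_bool (x \<in> A_at s) * 2 ^ x)" by (intro comp dec_A_at)
  moreover have "A_at s = set_decode (\<Sum>x<s. of_bool (x \<in> A_at s) * 2 ^ x)" for s
    unfolding set_eq_iff set_decode_sum using A_at_less by blast
  ultimately show "\<exists>f. computable f \<and> (\<forall>s. A_at s = set_decode (f s))"
    by (intro exI[of _ "\<lambda>s. \<Sum>x<s. of_bool (x \<in> A_at s) * 2 ^ x"]) blast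
  show "A_at s \<subseteq> A_at (Suc s)" for s by (rule A_at_mono) simp
  show "(\<Union>s. A_at s) = A" by (auto simp: A_at_def A_def)
qed

text \<open>The chain \<open>B\<close> in the next lemma answers a question about \<open>x\<close> only after \<open>x\<close> has been kept out
  of \<open>A\<close> for as long as \<open>p\<close> demands. Since \<open>Q\<close> holds of this chain, an element that entered \<open>A\<close>
  too early would never be answered and so contradict \<open>Psi\<close>. The parameter \<open>K\<close> leaves room for
  correcting finitely many numbers.\<close>

lemma slow_chain:
  assumes p: "computable p"
  shows "\<exists>d i. (\<forall>K l. W (d K l) = D i l - {..<K}) \<and>
    (\<forall>l. BB i l = {x. \<exists>u. (\<forall>K\<le>x. x \<in> W_at (d K l) u) \<and> x \<notin> A_at (p u)})"
proof -
  let ?S = "{z. \<exists>u. p1 (p1 z) \<le> p2 z \<and> inD state u (p1 (p2 (p1 z))) (p2 (p2 (p1 z))) (p2 z)}"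
  have "ce ?S" by (rule ceI) (intro comp)
  then obtain e where e: "W e = ?S" by (auto simp: ce_def)
  obtain c where c: "computable c" "\<And>y. W (c y) = {x. prod_encode (y, x) \<in> W e}" using smn by blast
  let ?c = "\<lambda>K i l. c (prod_encode (K, prod_encode (i, l)))"
  have W: "W (?c K i l) = D i l - {..<K}" for K i l
    unfolding c(2) e D_def by auto
  \<comment> \<open>The component \<open>p1 (p1 w)\<close> will receive the chain's own index, so
    the chain waits for the sets \<open>D\<close> that respond to itself.\<close>
  have "decidable (\<lambda>w. (\<forall>K\<le>p2 (p2 (p1 w)). p2 (p2 (p1 w)) \<in>
      W_at (?c K (p1 (p1 w)) (p1 (p2 (p1 w)))) (p2 w)) \<and> p2 (p2 (p1 w)) \<notin> A_at (p (p2 w)))"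
    by (intro comp dec_A_at comp_comp[OF c(1)] comp_comp[OF p])
  from semidecidable[OF this] obtain i where i: "W i = {z. \<exists>u. (\<forall>K\<le>p2 (p2 z). p2 (p2 z) \<in>
      W_at (?c K (p1 z) (p1 (p2 z))) u) \<and> p2 (p2 z) \<notin> A_at (p u)}" by blast
  have "BB i l = {x. \<exists>u. (\<forall>K\<le>x. x \<in> W_at (?c K i l) u) \<and> x \<notin> A_at (p u)}" for l
    unfolding BB_def i by simp
  then show ?thesis
    by (intro exI[of _ "\<lambda>K l. ?c K i l"] exI[of _ i] conjI allI W)
qed

text \<open>Up to finitely many corrections, the complement of \<open>A\<close> is the union of the
  differences \<open>T l - D i l\<close> over the \<open>k\<close> rounds, together with
  \<open>Y\<close> if \<open>m\<close> is odd. A number of \<open>A\<close> that occurs in a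
  difference at stage \<open>s\<close> is answered later, and the answer certifies that it was not
  yet in \<open>A\<close> at stage \<open>p s\<close>.\<close>

lemma tardy_A: "tardy m A"
  unfolding tardy_def
proof (intro exI[of _ A_at] conjI allI impI)
  show "computable_enumeration A_at A" by (rule enumeration_A)
  fix p assume "computable p \<and> mono p"
  then have p: "computable p" "mono p" by auto
  from slow_chain[OF p(1)] obtain d i where di: "(\<forall>K l. W (d K l) = D i l - {..<K}) \<and>
    (\<forall>l. BB i l = {x. \<exists>u. (\<forall>K\<le>x. x \<in> W_at (d K l) u) \<and> x \<notin> A_at (p u)})" by (elim exE)
  have d: "W (d K l) = D i l - {..<K}" for K l
    by (rule conjunct1[OF di, THEN spec, THEN spec])
  have B: "BB i l = {x. \<exists>u. (\<forall>K\<le>x. x \<in> W_at (d K l) u) \<and> x \<notin> A_at (p u)}" for l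
    by (rule conjunct2[OF di, THEN spec])
  have BD: "BB i l \<subseteq> D i l" for l
  proof
    fix x assume "x \<in> BB i l"
    then obtain u where "x \<in> W_at (d 0 l) u" unfolding B by blast
    then show "x \<in> D i l" using W_at_subset d[of 0 l] by blast
  qed
  have DB: "x \<in> BB i l" if "x \<in> D i l" "x \<notin> A" for x l
  proof -
    have "\<forall>\<^sub>F u in sequentially. \<forall>K\<in>{..x}. x \<in> W_at (d K l) u \<longleftrightarrow> x \<in> W (d K l)"
      by (intro eventually_ball_finite ballI eventually_W_at) simp
    then obtain u where "\<forall>K\<in>{..x}. x \<in> W_at (d K l) u \<longleftrightarrow> x \<in> W (d K l)"
      using eventually_happens'[OF sequentially_bot] by blast
    then have "\<forall>K\<le>x. x \<in> W_at (d K l) u" using d that by auto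
    then show ?thesis unfolding B using that(2) A_at_subset by blast
  qed
  \<comment> \<open>This requirement belongs to the splitting with \<open>S = C\<close>.\<close>
  obtain w a b where wab: "W w = UNIV" "W a = C" "W b = {}"
    using ce_UNIV ce_C ce_finite[OF finite.emptyI] unfolding ce_def by fastforce
  define e where "e = prod_encode (w, prod_encode (i, prod_encode (a, b)))"
  have e: "i_of e = i" "a_of e = a" by (simp_all add: e_def)
  have "e \<in> TP" unfolding e_def
  proof (rule TP_I)
    show "BB i l \<inter> (W a \<inter> C - H) = D i l \<inter> (W a \<inter> C - H)" for l
      using BD[of l] DB[of _ l] H_eq by blast
  qed (use wab in auto)
  have "W (a_of e) \<subseteq> C" using wab e by blast
  from psi_chain[OF \<open>e \<in> TP\<close> this] obtain T where T': "ce_chain k T \<and> - C \<subseteq> T 1 \<and>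
    (\<forall>l x. 1 \<le> l \<and> l \<le> k \<and> x \<in> W a \<inter> T l \<longrightarrow>
      (x \<in> H \<or> (l < k \<and> x \<in> T (l + 1)) \<longleftrightarrow> x \<in> BB i l))"
    unfolding e by (elim exE)
  then have T: "ce_chain k T" "- C \<subseteq> T 1" by simp_all
  have psi: "x \<in> H \<or> (l < k \<and> x \<in> T (l + 1)) \<longleftrightarrow> x \<in> BB i l"
    if "1 \<le> l" "l \<le> k" "x \<in> C" "x \<in> T l" for l x
    using T' that wab by simp
  have ceT: "ce (T l)" if "1 \<le> l" "l \<le> k" for l using T(1) that by (simp add: ce_chain_def)
  obtain w1 where w1: "T 1 = W w1" using ceT[of 1] k1 by (auto simp: ce_def)
  have "finite (- H - T 1)" using major[of w1] T(2) w1 by simp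
  then obtain K where K: "- H - T 1 \<subseteq> {..<K}" unfolding finite_nat_set_iff_bounded by auto
  \<comment> \<open>Below \<open>K\<close> the correct membership is written into the first set by
    hand; the other sets are cut off there.\<close>
  define T' where "T' l = (if l = 1 then (T 1 - {..<K}) \<union> ({..<K} - A) else T l - {..<K})" for l
  have "ce (T' l)" if "1 \<le> l" "l \<le> k" for l
  proof -
    have "ce (T 1 - {..<K} \<union> ({..<K} - A))" "ce (T l - {..<K})"
      using ceT k1 that by (simp_all add: ce_Un ce_Diff_finite ce_finite)
    then show ?thesis by (simp add: T'_def)
  qed
  then obtain t where t: "\<And>l. 1 \<le> l \<Longrightarrow> l \<le> k \<Longrightarrow> W (t l) = T' l" unfolding ce_def by metis
  obtain y where y: "W y = Y" using ce_Y unfolding ce_def by metis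
  define R where "R = (if odd m then [y] else [])"
  define es where "es = concat (map (\<lambda>l. [t l, d K l]) [1..<Suc k]) @ R"
  have len: "length es = m"
    unfolding es_def R_def length_append length_pairs using k by (auto simp del: upt_Suc)
  then obtain c where c: "tuple_decode m c = es"
    using tuple_decode_surj[of es "m - 1"] m2 by auto
  have X: "X_nce m c = (\<Union>l\<in>{1..k}. T' l - (D i l - {..<K})) \<union> Y"
  proof -
    have "alt_union (map W R) = Y" using Y_even by (simp add: R_def y)
    moreover have "map W (concat (map (\<lambda>l. [t l, d K l]) [1..<Suc k])) =
        concat (map (\<lambda>l. [W (t l), W (d K l)]) [1..<Suc k])"
      by (simp add: map_concat o_def del: upt_Suc)
    ultimately have "X_nce m c = (\<Union>l\<in>set [1..<Suc k]. W (t l) - W (d K l)) \<union> Y"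
      unfolding X_nce_def c es_def map_append by (simp only: alt_union_pairs)
    also have "\<dots> = (\<Union>l\<in>{1..k}. T' l - (D i l - {..<K})) \<union> Y"
      using t d by (intro arg_cong2[of _ _ _ _ "(\<union>)"] SUP_cong refl) auto
    finally show ?thesis .
  qed
  have X_at: "X_nce_at m c s \<subseteq> (\<Union>l\<in>{1..k}. W_at (t l) s - W_at (d K l) s) \<union> Y" for s
  proof -
    have "alt_union (map (\<lambda>i. W_at i s) R) \<subseteq> Y" using W_at_subset[of y s] by (simp add: R_def y)
    moreover have "map (\<lambda>i. W_at i s) (concat (map (\<lambda>l. [t l, d K l]) [1..<Suc k])) =
        concat (map (\<lambda>l. [W_at (t l) s, W_at (d K l) s]) [1..<Suc k])"
      by (simp add: map_concat o_def del: upt_Suc)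
    moreover have "set [1..<Suc k] = {1..k}" by auto
    ultimately show ?thesis
      unfolding X_nce_at_def c es_def map_append by (simp only: alt_union_pairs) blast
  qed
  have T'A: "x \<notin> A" if "x \<in> T' l" "x < K" for x l
    using that by (auto simp: T'_def split: if_splits)
  have T'T: "x \<in> T l" if "x \<in> T' l" "\<not> x < K" for x l
    using that by (auto simp: T'_def split: if_splits)
  have AH: "A \<subseteq> H" using H_eq by simp
  have YA: "Y \<subseteq> - A" using A_Y_disjoint by blast
  have "X_nce m c = - A"
  proof (intro equalityI subsetI)
    fix x assume "x \<in> X_nce m c"
    then consider "x \<in> Y" | l where "1 \<le> l" "l \<le> k" "x \<in> T' l" "x \<notin> D i l \<or> x < K"
      unfolding X by auto
    then show "x \<in> - A"
    proof cases
      case 1 then show ?thesis using YA by blast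
    next
      case 2
      show ?thesis
      proof (cases "x < K \<or> x \<notin> C")
        case True then show ?thesis using T'A[OF 2(3)] AH H_subset_C by blast
      next
        case False
        then have "x \<notin> BB i l" using 2(4) BD by blast
        then have "x \<notin> H" using psi[OF 2(1,2) _ T'T[OF 2(3)]] False by blast
        then show ?thesis using AH by blast
      qed
    qed
  next
    fix x assume x: "x \<in> - A"
    show "x \<in> X_nce m c"
    proof (cases "x \<in> Y \<or> x < K")
      case True
      have "1 \<in> {1..k}" "x < K \<Longrightarrow> x \<in> T' 1 - (D i 1 - {..<K})" using x k1 by (auto simp: T'_def)
      then show ?thesis using True unfolding X by blast
    next
      case False
      then have xH: "x \<notin> H" using x H_eq by blast
      then have x1: "x \<in> T 1" using K False by blast
      \<comment> \<open>In the last \<open>T l\<close> that contains it, \<open>x\<close> cannot be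
        in \<open>D i l\<close>: the answer would carry it into \<open>T (l + 1)\<close> or
        \<open>H\<close>.\<close>
      let ?L = "{l. 1 \<le> l \<and> l \<le> k \<and> x \<in> T l}"
      have fin: "finite ?L" by simp
      have "1 \<in> ?L" using x1 k1 by simp
      then have L: "Max ?L \<in> ?L" using Max_in[OF fin] by blast
      define l where "l = Max ?L"
      have l: "1 \<le> l" "l \<le> k" "x \<in> T l" using L by (simp_all add: l_def)
      have "x \<notin> D i l"
      proof
        assume xD: "x \<in> D i l"
        then have "x \<in> C" "x \<in> BB i l" using D_subset_C[OF l(1)] DB x by auto
        then have "l < k" "x \<in> T (l + 1)" using psi[OF l(1,2) _ l(3)] xH by auto
        then have "l + 1 \<le> l" unfolding l_def by (intro Max_ge[OF fin]) (use l in \<open>simp add: l_def\<close>)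
        then show False by simp
      qed
      moreover have "x \<in> T' l" using l False x1 by (auto simp: T'_def)
      ultimately show ?thesis unfolding X using l by auto
    qed
  qed
  moreover have "x \<notin> A_at (p s)" if xX: "x \<in> X_nce_at m c s" for x s
  proof (cases "x \<in> A")
    case True
    have "x \<in> (\<Union>l\<in>{1..k}. W_at (t l) s - W_at (d K l) s) \<union> Y" by (rule subsetD[OF X_at xX])
    moreover have "x \<notin> Y" using True YA by blast
    ultimately obtain l where l: "1 \<le> l" "l \<le> k" "x \<in> W_at (t l) s" "x \<notin> W_at (d K l) s" by auto
    then have xT': "x \<in> T' l" using t W_at_subset by blast
    then have xK: "\<not> x < K" using T'A True by blast
    have "x \<in> C" "x \<in> H" using True AH H_subset_C by auto
    then have "x \<in> BB i l" using psi[OF l(1,2) _ T'T[OF xT' xK]] by blast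
    then obtain u where u: "x \<in> W_at (d K l) u" "x \<notin> A_at (p u)" using xK unfolding B by (auto simp: not_less)
    \<comment> \<open>At stage \<open>s\<close> the set \<open>D\<close> has not yet shown
      \<open>x\<close>, so the answer comes no earlier.\<close>
    have "s \<le> u" using W_at_mono[of u s "d K l"] u(1) l(4) by (cases "s \<le> u") auto
    then have "A_at (p s) \<subseteq> A_at (p u)" using p(2) by (intro A_at_mono) (simp add: mono_def)
    then show ?thesis using u(2) by blast
  qed (use A_at_subset in blast)
  ultimately show "\<exists>e. X_nce m e = - A \<and> (\<forall>x s. x \<in> X_nce_at m e s \<longrightarrow> x \<notin> A_at (p s))" by blast
qed

text \<open>The membership of an element \<open>x\<close> that is never refuted in the \<open>(m - 1)\<close>-c.e. set of its level
  alternates with the parity of the status of \<open>x\<close>, which is thus bounded by the number of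
  alternations.\<close>

lemma not_tardy_A: "\<not> tardy (m - 1) A"
proof
  assume "tardy (m - 1) A"
  then obtain As where As: "computable_enumeration As A"
    and ta: "\<And>p. computable p \<Longrightarrow> mono p \<Longrightarrow>
      \<exists>e. X_nce (m - 1) e = - A \<and> (\<forall>x s. x \<in> X_nce_at (m - 1) e s \<longrightarrow> x \<notin> As (p s))"
    unfolding tardy_def by blast
  obtain f where f: "computable f" "\<And>s. As s = set_decode (f s)" and As_Suc: "\<And>s. As s \<subseteq> As (Suc s)"
    and As_A: "(\<Union>s. As s) = A"
    using As unfolding computable_enumeration_def by blast
  have As_mono: "s \<le> s' \<Longrightarrow> As s \<subseteq> As s'" for s s' using lift_Suc_mono_le[of As] As_Suc by blast
  have ex: "\<exists>t. \<forall>x<Suc s. x \<in> A_at (Suc s) \<longrightarrow> x \<in> As t" for s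
  proof -
    have "\<forall>\<^sub>F t in sequentially. \<forall>x\<in>{..<Suc s}. x \<in> As t \<longleftrightarrow> (\<exists>t. x \<in> As t)"
      by (intro eventually_ball_finite ballI eventually_mono_ex) (use As_mono in auto)
    then obtain t where "\<forall>x\<in>{..<Suc s}. x \<in> As t \<longleftrightarrow> (\<exists>t. x \<in> As t)"
      using eventually_happens'[OF sequentially_bot] by blast
    then show ?thesis using As_A A_at_subset by blast
  qed
  \<comment> \<open>At \<open>p s\<close> the given enumeration has caught up with stage
    \<open>Suc s\<close>, so putting a number into \<open>A\<close> at once while the opponent's set
    contains it contradicts tardiness.\<close>
  define p where "p s = (LEAST t. \<forall>x<Suc s. x \<in> A_at (Suc s) \<longrightarrow> x \<in> As t)" for s
  have p: "A_at (Suc s) \<subseteq> As (p s)" for s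
    using LeastI_ex[OF ex[of s]] A_at_less unfolding p_def by blast
  have "computable p"
    unfolding p_def f(2)
    by (rule comp_Least) (intro comp dec_A_at comp_comp[OF f(1)], use ex f(2) in simp)
  moreover have "mono p"
  proof (rule monoI)
    fix s s' :: nat assume "s \<le> s'"
    then have "A_at (Suc s) \<subseteq> As (p s')" using p[of s'] A_at_mono[of "Suc s" "Suc s'"] by auto
    then show "p s \<le> p s'" unfolding p_def[of s] by (intro Least_le) blast
  qed
  ultimately obtain e where e: "X_nce (m - 1) e = - A"
    and quick: "\<And>x s. x \<in> X_nce_at (m - 1) e s \<Longrightarrow> x \<notin> As (p s)"
    using ta by blast
  obtain x where x: "x \<in> C" "right (2 * e) x" and unref: "\<And>s. \<not> refuted state s x"
    using witness by blast
  let ?X = "\<lambda>s. x \<in> X_nce_at (m - 1) e s"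
  define h where "h s = hits (tuple_decode (m - 1) e) s x" for s
  have h_le: "h s \<le> m - 1" for s
    using hits_le[of "tuple_decode (m - 1) e" s x] by (simp add: h_def length_tuple_decode)
  have h_less: "s \<le> s' \<Longrightarrow> ?X s \<noteq> ?X s' \<Longrightarrow> h s < h s'" for s s'
    unfolding h_def X_nce_at_def by (rule hits_change)
  have trig: "trigger s x \<longleftrightarrow> ?X s" for s using x(2) by (simp add: trigger_def right_def)
  have quick': "v (Suc s) x \<noteq> 2 * k + 2" if "?X s" for s
    using quick[OF that] p[of s] by (auto simp: A_at_def)
  \<comment> \<open>Here \<open>s1\<close> is the stage of the last move, or 0 just after entry.
    Every further move needs a change of the opponent's set, so the count \<open>h\<close> keeps up
    with the status.\<close>
  have inv: "v s x \<noteq> 0 \<Longrightarrow> v s x \<noteq> 2 * k + 2 \<Longrightarrow>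
      \<exists>s1\<le>s. (?X s1 \<longleftrightarrow> even (v s x)) \<and> v s x \<le> h s1 + 1" for s
  proof (induction s)
    case (Suc s)
    have vs: "v s x \<noteq> 2 * k + 2" using Suc.prems v_mono[of s "Suc s" x] v_le[of "Suc s" x] by auto
    show ?case
    proof (cases "v (Suc s) x = v s x")
      case True
      then show ?thesis using Suc vs le_SucI by metis
    next
      case False
      then have j: "v (Suc s) x = v s x + 1" using v_step[of s x] Suc.prems by auto
      show ?thesis
      proof (cases "v s x = 0")
        case True
        then show ?thesis using j X_nce_at_0 by (intro exI[of _ 0]) simp
      next
        case False2: False
        obtain s1 where s1: "s1 \<le> s" "?X s1 \<longleftrightarrow> even (v s x)" "v s x \<le> h s1 + 1"
          using Suc.IH False2 vs by blast
        have "?X s \<longleftrightarrow> odd (v s x)"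
          using j False2 unref[of s] Suc.prems(2)
          by (auto simp: v_Suc new_val_def trig split: if_splits)
        then have "h s1 < h s" using h_less[OF s1(1)] s1(2) by blast
        then show ?thesis using s1(3) j \<open>?X s \<longleftrightarrow> odd (v s x)\<close> by (intro exI[of _ s]) auto
      qed
    qed
  qed (simp add: v_0)
  have xA: "v s x \<noteq> 2 * k + 2" for s
  proof (induction s)
    case (Suc s)
    show ?case
    proof
      assume new: "v (Suc s) x = 2 * k + 2"
      have nX: "\<not> ?X s" using new quick' by blast
      have n1: "v s x \<noteq> 2 * k + 1" using v_final[of s "Suc s" x] new by auto
      then have step: "even (v s x)" "2 \<le> v s x" "v s x \<le> 2 * k"
        using v_step[of s x] new Suc.IH by auto
      then have "v s x = 2 * k" "even m"
        using new unref[of s] nX n1 by (auto simp: v_Suc new_val_def trig split: if_splits)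
      obtain s1 where s1: "s1 \<le> s" "?X s1 \<longleftrightarrow> even (v s x)" "v s x \<le> h s1 + 1"
        using inv[of s] step Suc.IH by auto
      then have "h s1 < h s" using h_less[of s1 s] nX step(1) by blast
      \<comment> \<open>Now \<open>h s \<ge> 2 * k = m\<close> exceeds the number of
        components.\<close>
      then show False
        using s1(3) h_le[of s] \<open>v s x = 2 * k\<close> \<open>even m\<close> k m2 by auto
    qed
  qed (simp add: v_0)
  then have "x \<in> X_nce (m - 1) e" unfolding e by (simp add: A_def)
  then obtain N where N: "\<And>s. s \<ge> N \<Longrightarrow> ?X s"
    using eventually_X_nce_at[of x "m - 1" e] unfolding eventually_sequentially by blast
  obtain s0 where "v s0 x \<noteq> 0" using x(1) by (auto simp: C_def)
  obtain s2 where s2: "s2 \<ge> max s0 N" "\<And>s. s \<ge> s2 \<Longrightarrow> v s x = v s2 x"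
    using v_stable[of "max s0 N" x] by blast
  have X2: "?X s2" and n0: "v s2 x \<noteq> 0"
    using N s2(1) v_mono[of s0 s2 x] \<open>v s0 x \<noteq> 0\<close> by auto
  have stay: "v (Suc s2) x = v s2 x" using s2(2)[of "Suc s2"] by simp
  obtain s1 where s1: "s1 \<le> s2" "?X s1 \<longleftrightarrow> even (v s2 x)" "v s2 x \<le> h s1 + 1"
    using inv[OF n0 xA] by blast
  have le: "v s2 x \<le> 2 * k"
  proof (rule ccontr)
    assume "\<not> v s2 x \<le> 2 * k"
    then have eq: "v s2 x = 2 * k + 1" using v_le[of s2 x] xA[of s2] by linarith
    then have "odd m" using Y_even by (auto simp: Y_def)
    \<comment> \<open>The return of \<open>x\<close> into the opponent's set after status
      \<open>2 * k + 1\<close> would need \<open>2 * k + 1 = m\<close> components.\<close>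
    have "h s1 < h s2" using h_less[OF s1(1)] s1(2) X2 eq by simp
    then show False using h_le[of s2] s1(3) eq \<open>odd m\<close> k m2 by (auto elim: oddE)
  qed
  \<comment> \<open>An odd status would be raised, because the opponent's set contains
    \<open>x\<close>.\<close>
  have "even (v s2 x)"
    using stay n0 le X2 by (auto simp: v_Suc new_val_def trig split: if_splits)
  then obtain l where l: "v s2 x = 2 * l" by blast
  \<comment> \<open>The guess of \<open>x\<close> is correct, so all requirements asked are true and
    the round ends.\<close>
  have "\<exists>s\<ge>s2. 2 * l < v s x"
  proof (rule progress[OF l, of "level x"])
    show "1 \<le> l" "l \<le> k" using l n0 le by simp_all
    show "r \<in> TP" if "asked state s2 x r" for r
      using that x(2) by (auto simp: asked_def right_def)
  qed (simp add: asked_def)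
  then obtain s where "s \<ge> s2" "2 * l < v s x" by blast
  then show False using s2(2)[of s] l by simp
qed

end

theorem theorem4p1:
  fixes m :: nat
  assumes "m \<ge> 2"
  shows "\<exists>A :: nat set. ce A \<and> properly_tardy m A \<and> Q m A"
proof -
  interpret construction m "m div 2" using assms by unfold_locales simp_all
  show ?thesis using ce_A tardy_A not_tardy_A Q_A unfolding properly_tardy_def by blast
qed

end
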